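(* Let $\mathbf\Psi$ be a decomposable triangle family. Then the triangle centers given by the triangle center functions in $$\Omega:=\Gamma\cup\Gamma^{-1}\cup\Xi\cup\Xi^{-1}$$ are semi-invariant curve-generating centers (with respect to $\mathbf\Psi$). In particular: - If $\mathbf\Psi=\mathbf\Phi_A$ (the aliquot family), the triangle curves are sheared Maclaurin trisectrices. - If $\mathbf\Psi=\mathbf\Phi_N$ (the nedian family), the triangle curves are sheared Limaçon trisectrices. Furthermore, among these triangle center functions, only the triangle centers $$\Omega_{\mathrm{inv}}:=\{\mathbf X_{13},\mathbf X_{14},\mathbf X_{15},\mathbf X_{16}\}$$ are invariant.
   Context: **Triangles and centers.** $\triangle$ is the set of non-degenerate triangles $\Delta=(\mathbf A,\mathbf B,\mathbf C)$ in $\mathbb R^2$, with side lengths $a=|\mathbf B\mathbf C|$, $b=|\mathbf C\mathbf A|$, $c=|\mathbf A\mathbf B|$ and area $\mathrm{area}(\Delta)$. A triangle center function is a real function $\psi\not\equiv0$ of $(a,b,c)$ that is homogeneous of some real degree $r$ ($\psi(sa,sb,sc)=s^r\psi(a,b,c)$ for all $s>0$) and satisfies $\psi(a,b,c)=\psi(a,c,b)$. It defines the triangle center $\mathbf X_\psi$ with trilinear coordinates $[\psi(a,b,c):\psi(b,c,a):\psi(c,a,b)]$, i.e. the point $$\mathbf X_\psi=\frac{a\psi(a,b,c)\mathbf A+b\psi(b,c,a)\mathbf B+c\psi(c,a,b)\mathbf C}{a\psi(a,b,c)+b\psi(b,c,a)+c\psi(c,a,b)}.$$ **The sets.** Put $$\psi_{\Gamma;\lambda_0:\lambda_1}(a,b,c)=\sqrt3\,a(-a^2+b^2+c^2)\lambda_0+4a\,\mathrm{area}(\Delta)\lambda_1,$$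 $$\psi_{\Xi;\lambda_0:\lambda_1}(a,b,c)=-a(-a^2+b^2+c^2)\lambda_0+a(a^2+b^2+c^2)\lambda_1 .$$ $\Gamma$ and $\Xi$ are the sets of all $\psi_{\Gamma;\lambda_0:\lambda_1}$, resp. all $\psi_{\Xi;\lambda_0:\lambda_1}$, with $\lambda_0,\lambda_1\in\mathbb R$; $\Gamma^{-1}$ and $\Xi^{-1}$ are the sets of the reciprocals $\psi_{\Gamma;\lambda_0:\lambda_1}^{-1}$, resp. $\psi_{\Xi;\lambda_0:\lambda_1}^{-1}$. The isodynamic centers $\mathbf X_{15}$ and $\mathbf X_{16}$ correspond to $\psi_{\Gamma;1:1}$ and $\psi_{\Gamma;-1:1}$; the isogonic centers $\mathbf X_{13}$ and $\mathbf X_{14}$ correspond to $\psi_{\Gamma;1:1}^{-1}$ and $\psi_{\Gamma;-1:1}^{-1}$. **Triangle families.** A triangle family $t\mapsto\Delta_t^{\mathbf\Psi}\in\triangle$ is determined by a triangle $\Delta\in\triangle$ and three functions $\mathbf\Psi=(\Psi_1,\Psi_2,\Psi_3):\mathbb R\to\mathbb R^3$ such that $\Psi_1(t)+\Psi_2(t)+\Psi_3(t)\neq0$ and not $\Psi_1(t)\equiv\Psi_2(t)\equiv\Psi_3(t)$; the vertices of $\Delta_t^{\mathbf\Psi}$ have homogeneous barycentric coordinates (with respect to $\mathbf A,\mathbf B,\mathbf C$) $\mathbf A_t=[\Psi_1:\Psi_2:\Psi_3]$, $\mathbf B_t=[\Psi_3:\Psi_1:\Psi_2]$, $\mathbf C_t=[\Psi_2:\Psi_3:\Psi_1]$,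 evaluated at $t$. The family is decomposable if for all $t\in\mathbb R$, $2\Psi_1(t)-\Psi_2(t)-\Psi_3(t)=0$ implies $\Psi_1(t)=\Psi_2(t)=\Psi_3(t)$. Aliquot family: $\mathbf\Phi_A(t)=(0,1-t,t)$. Nedian family: $\mathbf\Phi_N(t)=((1-t)t,\,t^2,\,(1-t)^2)$. **Triangle curves.** The triangle curve $t\mapsto\mathbf X_\psi^{\mathbf\Psi}(t)$ is the curve traced by the triangle center determined by $\psi$ in the triangles $\Delta_t^{\mathbf\Psi}$. Equilateral triangles $\Delta$ are excluded throughout. $\mathbf X_\psi$ is a semi-invariant curve-generating center with respect to $\mathbf\Psi$ if, for all triangles $\Delta\in\triangle$, the curves $t\mapsto\mathbf X_\psi^{\mathbf\Psi}(t)$ differ only by an affine transformation. It is an invariant curve-generating center with respect to $\mathbf\Psi$ if, for all $\Delta\in\triangle$, these curves differ only by translation, rotation, scaling, or reflection. **Trisectrices.** With a parameter $k$, the Maclaurin trisectrix is the plane algebraic curve $2x(x^2+y^2)=k(3x^2-y^2)$, and the Limaçon trisectrix is $k^2(x^2+y^2)=(x^2+y^2-2kx)^2$. "Sheared" means transformed by an affine transformation.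
   Formalization: Triangles whose curve always lies on a line (or center at infinity) are exempt from invertibility and the trisectrix claims (finitely many Brocard angles unless centroid); curves may miss finitely many points; "only" is claimed when some triangle's curve is not on a line. *)

theory Defs
  imports "HOL-Analysis.Analysis"
begin

type_synonym point = "real ^ 2"
type_synonym triangle = "point \<times> point \<times> point"

definition triangles :: "triangle set" where
  "triangles = {(A, B, C). \<not> collinear {A, B, C}}"

fun side_a :: "triangle \<Rightarrow> real" where "side_a (A, B, C) = dist B C"
fun side_b :: "triangle \<Rightarrow> real" where "side_b (A, B, C) = dist C A"
fun side_c :: "triangle \<Rightarrow> real" where "side_c (A, B, C) = dist A B"

definition equilateral :: "triangle \<Rightarrow> bool" where
  "equilateral \<Delta> \<longleftrightarrow> side_a \<Delta> = side_b \<Delta> \<and> side_b \<Delta> = side_c \<Delta>"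

text \<open>Equilateral triangles are excluded throughout.\<close>

definition base_triangles :: "triangle set" where
  "base_triangles = {\<Delta> \<in> triangles. \<not> equilateral \<Delta>}"

text \<open>The area as a function of the side lengths (Heron's formula).\<close>

definition area :: "real \<Rightarrow> real \<Rightarrow> real \<Rightarrow> real" where
  "area a b c = (let s = (a + b + c) / 2 in sqrt (s * (s - a) * (s - b) * (s - c)))"

lemma area_eq_content:
  fixes A B C :: point
  shows "area (dist B C) (dist C A) (dist A B) = measure lborel (convex hull {A, B, C})"
  using heron[of A B C] by (simp add: area_def Let_def dist_commute)

text \<open>Functions of the side lengths are partial: a reciprocal is undefined
  where the function vanishes.\<close>

type_synonym side_fun = "real \<Rightarrow> real \<Rightarrow> real \<Rightarrow> real option"

definition side_lengths :: "real \<Rightarrow> real \<Rightarrow> real \<Rightarrow> bool" where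
  "side_lengths a b c \<longleftrightarrow> a < b + c \<and> b < c + a \<and> c < a + b"

definition triangle_center_function :: "side_fun \<Rightarrow> bool" where
  "triangle_center_function \<psi> \<longleftrightarrow>
     (\<exists>a b c v. side_lengths a b c \<and> \<psi> a b c = Some v \<and> v \<noteq> 0) \<and>
     (\<exists>r. \<forall>a b c s. side_lengths a b c \<longrightarrow> s > 0 \<longrightarrow>
        \<psi> (s * a) (s * b) (s * c) = map_option (\<lambda>v. s powr r * v) (\<psi> a b c)) \<and>
     (\<forall>a b c. side_lengths a b c \<longrightarrow> \<psi> a b c = \<psi> a c b)"

definition recip :: "side_fun \<Rightarrow> side_fun" where
  "recip \<psi> = (\<lambda>a b c. case \<psi> a b c of None \<Rightarrow> None
                         | Some v \<Rightarrow> if v = 0 then None else Some (1 / v))"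

definition psi_Gamma :: "real \<Rightarrow> real \<Rightarrow> side_fun" where
  "psi_Gamma l0 l1 = (\<lambda>a b c.
     Some (sqrt 3 * a * (- a\<^sup>2 + b\<^sup>2 + c\<^sup>2) * l0 + 4 * a * area a b c * l1))"

definition psi_Xi :: "real \<Rightarrow> real \<Rightarrow> side_fun" where
  "psi_Xi l0 l1 = (\<lambda>a b c.
     Some (- a * (- a\<^sup>2 + b\<^sup>2 + c\<^sup>2) * l0 + a * (a\<^sup>2 + b\<^sup>2 + c\<^sup>2) * l1))"

definition Gamma_set :: "side_fun set" where
  "Gamma_set = {psi_Gamma l0 l1 | l0 l1. True}"

definition Xi_set :: "side_fun set" where
  "Xi_set = {psi_Xi l0 l1 | l0 l1. True}"

definition Omega_set :: "side_fun set" where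
  "Omega_set = Gamma_set \<union> recip ` Gamma_set \<union> Xi_set \<union> recip ` Xi_set"

text \<open>A center is a partial map from triangles to points. It is undefined for degenerate
  triangles, where one of the three trilinear coordinates is undefined, and where the
  denominator vanishes (the point with these trilinear coordinates is then at infinity,
  or there is no such point).\<close>

type_synonym center = "triangle \<Rightarrow> point option"

fun center_of :: "side_fun \<Rightarrow> center" where
  "center_of \<psi> (A, B, C) =
     (let a = dist B C; b = dist C A; c = dist A B in
      case (\<psi> a b c, \<psi> b c a, \<psi> c a b) of
        (Some u, Some v, Some w) \<Rightarrow>
          (if (A, B, C) \<in> triangles \<and> a * u + b * v + c * w \<noteq> 0
           then Some ((1 / (a * u + b * v + c * w)) *\<^sub>R
                        ((a * u) *\<^sub>R A + (b * v) *\<^sub>R B + (c * w) *\<^sub>R C))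
           else None)
      | _ \<Rightarrow> None)"

fun centroid :: center where
  "centroid (A, B, C) =
     (if (A, B, C) \<in> triangles then Some ((1 / 3) *\<^sub>R (A + B + C)) else None)"

definition X13 :: center where "X13 = center_of (recip (psi_Gamma 1 1))"
definition X14 :: center where "X14 = center_of (recip (psi_Gamma (-1) 1))"
definition X15 :: center where "X15 = center_of (psi_Gamma 1 1)"
definition X16 :: center where "X16 = center_of (psi_Gamma (-1) 1)"

definition Omega_inv :: "center set" where
  "Omega_inv = {X13, X14, X15, X16}"

definition triangle_family :: "(real \<Rightarrow> real ^ 3) \<Rightarrow> bool" where
  "triangle_family \<Psi> \<longleftrightarrow>
     (\<forall>t. \<Psi> t $ 1 + \<Psi> t $ 2 + \<Psi> t $ 3 \<noteq> 0) \<and>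
     \<not> (\<forall>t. \<Psi> t $ 1 = \<Psi> t $ 2 \<and> \<Psi> t $ 2 = \<Psi> t $ 3)"

definition decomposable :: "(real \<Rightarrow> real ^ 3) \<Rightarrow> bool" where
  "decomposable \<Psi> \<longleftrightarrow> triangle_family \<Psi> \<and>
     (\<forall>t. 2 * \<Psi> t $ 1 - \<Psi> t $ 2 - \<Psi> t $ 3 = 0 \<longrightarrow>
          \<Psi> t $ 1 = \<Psi> t $ 2 \<and> \<Psi> t $ 2 = \<Psi> t $ 3)"

text \<open>The point with barycentric coordinates [u : v : w].\<close>

fun barycentric :: "triangle \<Rightarrow> real \<Rightarrow> real \<Rightarrow> real \<Rightarrow> point" where
  "barycentric (A, B, C) u v w = (1 / (u + v + w)) *\<^sub>R (u *\<^sub>R A + v *\<^sub>R B + w *\<^sub>R C)"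

definition family_triangle :: "(real \<Rightarrow> real ^ 3) \<Rightarrow> triangle \<Rightarrow> real \<Rightarrow> triangle" where
  "family_triangle \<Psi> \<Delta> t =
     (barycentric \<Delta> (\<Psi> t $ 1) (\<Psi> t $ 2) (\<Psi> t $ 3),
      barycentric \<Delta> (\<Psi> t $ 3) (\<Psi> t $ 1) (\<Psi> t $ 2),
      barycentric \<Delta> (\<Psi> t $ 2) (\<Psi> t $ 3) (\<Psi> t $ 1))"

definition aliquot :: "real \<Rightarrow> real ^ 3" where
  "aliquot t = vector [0, 1 - t, t]"

definition nedian :: "real \<Rightarrow> real ^ 3" where
  "nedian t = vector [(1 - t) * t, t\<^sup>2, (1 - t)\<^sup>2]"

text \<open>The curve is undefined at the parameters where the family degenerates to a single
  point (for the nedian family, at 1/2) or where the center is undefined.\<close>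

definition triangle_curve :: "center \<Rightarrow> (real \<Rightarrow> real ^ 3) \<Rightarrow> triangle \<Rightarrow> real \<Rightarrow> point option" where
  "triangle_curve X \<Psi> \<Delta> t = X (family_triangle \<Psi> \<Delta> t)"

definition curve_trace :: "center \<Rightarrow> (real \<Rightarrow> real ^ 3) \<Rightarrow> triangle \<Rightarrow> point set" where
  "curve_trace X \<Psi> \<Delta> = {p. \<exists>t. triangle_curve X \<Psi> \<Delta> t = Some p}"

text \<open>For many of the functions considered there are exceptional triangles for which the
  center lies at infinity, or moves on a fixed line whatever the decomposable family.
  A curve on a line cannot be mapped to a genuine one by an invertible affine
  transformation. The following predicate singles out the triangles that are not exceptional.\<close>

definition curve_generating :: "center \<Rightarrow> triangle \<Rightarrow> bool" where
  "curve_generating X \<Delta> \<longleftrightarrow> (\<exists>\<Psi>. decomposable \<Psi> \<and> \<not> collinear (curve_trace X \<Psi> \<Delta>))"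

definition affine_map :: "(point \<Rightarrow> point) \<Rightarrow> bool" where
  "affine_map F \<longleftrightarrow> (\<exists>f v. linear f \<and> F = (\<lambda>x. f x + v))"

definition similarity_map :: "(point \<Rightarrow> point) \<Rightarrow> bool" where
  "similarity_map F \<longleftrightarrow>
     (\<exists>c f v. c > 0 \<and> orthogonal_transformation f \<and> F = (\<lambda>x. c *\<^sub>R f x + v))"

text \<open>Since the parameters at which the curve is undefined depend on the triangle, ``the curves
  differ only by transformations of a given kind'' is expressed by a common curve
  \<open>\<gamma>\<close> of which all of them are images. Consequently the curves of any two
  non-exceptional triangles are carried to one another, at all parameters where both are
  defined, by an invertible affine transformation. Only for exceptional triangles may the
  affine map fail to be invertible.\<close>

definition semi_invariant :: "center \<Rightarrow> (real \<Rightarrow> real ^ 3) \<Rightarrow> bool" where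
  "semi_invariant X \<Psi> \<longleftrightarrow>
     (\<exists>\<gamma> :: real \<Rightarrow> point. \<forall>\<Delta> \<in> base_triangles. \<exists>F. affine_map F \<and>
        (curve_generating X \<Delta> \<longrightarrow> bij F) \<and>
        (\<forall>t p. triangle_curve X \<Psi> \<Delta> t = Some p \<longrightarrow> p = F (\<gamma> t)))"

definition invariant :: "center \<Rightarrow> (real \<Rightarrow> real ^ 3) \<Rightarrow> bool" where
  "invariant X \<Psi> \<longleftrightarrow>
     (\<exists>\<gamma> :: real \<Rightarrow> point. \<forall>\<Delta> \<in> base_triangles. \<exists>F. similarity_map F \<and>
        (\<forall>t p. triangle_curve X \<Psi> \<Delta> t = Some p \<longrightarrow> p = F (\<gamma> t)))"

text \<open>The cotangent of the Brocard angle.\<close>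

definition brocard_cot :: "triangle \<Rightarrow> real" where
  "brocard_cot \<Delta> = ((side_a \<Delta>)\<^sup>2 + (side_b \<Delta>)\<^sup>2 + (side_c \<Delta>)\<^sup>2) /
                   (4 * area (side_a \<Delta>) (side_b \<Delta>) (side_c \<Delta>))"

definition maclaurin_trisectrix :: "real \<Rightarrow> point set" where
  "maclaurin_trisectrix k =
     {p. 2 * p $ 1 * ((p $ 1)\<^sup>2 + (p $ 2)\<^sup>2) = k * (3 * (p $ 1)\<^sup>2 - (p $ 2)\<^sup>2)}"

definition limacon_trisectrix :: "real \<Rightarrow> point set" where
  "limacon_trisectrix k =
     {p. k\<^sup>2 * ((p $ 1)\<^sup>2 + (p $ 2)\<^sup>2) = ((p $ 1)\<^sup>2 + (p $ 2)\<^sup>2 - 2 * k * p $ 1)\<^sup>2}"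

definition sheared :: "point set \<Rightarrow> point set \<Rightarrow> bool" where
  "sheared S T \<longleftrightarrow> (\<exists>F. affine_map F \<and> bij F \<and> T = F ` S)"

text \<open>A parametrized curve may miss finitely many points of the algebraic curve that it
  traces, such as the limit point for infinite parameter.\<close>

definition traces :: "point set \<Rightarrow> point set \<Rightarrow> bool" where
  "traces S T \<longleftrightarrow> S \<subseteq> T \<and> finite (T - S)"

end

theory Submission
  imports Defs
begin

text \<open>\<^bold>\<open>Why the theorem holds.\<close> Identify the plane with the complex numbers and apply the discrete
Fourier transform of order three to the vertices: with \<open>\<omega>\<close> a primitive third root of unity,
every triangle is

\<open>A = z0 + z1 + z2\<close>, \<open>B = z0 + \<omega> z1 + cnj \<omega> z2\<close>,
\<open>C = z0 + cnj \<omega> z1 + \<omega> z2\<close>,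

with \<open>z0\<close> the centroid. The triangle is degenerate iff \<open>z1\<close> and \<open>z2\<close> have equal modulus, and
equilateral iff one of them vanishes. The barycentric matrix of a triangle family is circulant, hence
diagonal in these coordinates: passing from the base triangle to the triangle at time \<open>t\<close> is
\<open>(z0, z1, z2) \<mapsto> (z0, \<mu> z1, cnj \<mu> z2)\<close> for one complex multiplier \<open>\<mu>\<close> that depends on the
family and on \<open>t\<close> but not on the base triangle (lemma \<open>family_triangle_tri\<close>).

All functions in question have the form
\<open>a (p (a\<^sup>2 + b\<^sup>2 + c\<^sup>2) + 4 q area - n a\<^sup>2)\<close>, or are reciprocals of such functions, and for
every choice of \<open>p, q, n\<close> their center is \<open>z0 + u U + v V\<close> (lemma \<open>quad_center_tri\<close>). Here
\<open>U = z1\<^sup>2 cnj z2\<close>, \<open>V = z2\<^sup>2 cnj z1\<close>, and the real numbers \<open>u, v\<close> depend only on the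
moduli \<open>P = |z1|\<^sup>2\<close> and \<open>Q = |z2|\<^sup>2\<close>, homogeneously of degree -1. Under the twist by \<open>\<mu>\<close>
the term \<open>u U\<close> is multiplied by the number \<open>\<gamma> = \<mu>\<^sup>2 / cnj \<mu>\<close> and \<open>v V\<close> by its conjugate. So
the curve is the image of the universal curve \<open>\<gamma>\<close> under the real affine map
\<open>z \<mapsto> z0 + \<alpha> z + \<beta> cnj z\<close> with \<open>\<alpha> = u U\<close> and \<open>\<beta> = v V\<close>, which is semi-invariance.

The map is singular iff \<open>|\<alpha>| = |\<beta>|\<close>. In the variable \<open>s = (P + Q) / |P - Q|\<close>, which is the
cotangent of the Brocard angle up to the factor \<open>sqrt 3\<close>, this is a quadratic equation, and so is the
condition that the center lies at infinity; hence only finitely many Brocard angles are exceptional,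
unless the center is the centroid, for which \<open>\<alpha> = \<beta> = 0\<close>.

For the aliquot family \<open>\<mu>\<close> runs through the line of real part -1/2, for the nedian family through a
circle through 0, and \<open>\<gamma> - 1\<close> runs through a Maclaurin trisectrix and a Limacon trisectrix,
respectively, up to finitely many points.

For the four isodynamic and isogonic centers one of \<open>u, v\<close> always vanishes, so the affine map is a
similarity. Conversely, multiplying \<open>z1\<close> by a number \<open>E\<close> of modulus 1 keeps \<open>P, Q\<close> and multiplies
\<open>\<alpha> cnj \<beta>\<close> by \<open>E\<^sup>3\<close>; if \<open>u v \<noteq> 0\<close>, three non-collinear points of the curve cannot form
similar triangles for all these \<open>E\<close> (lemma \<open>invariant_imp_coef_zero\<close>). That \<open>u v = 0\<close> for all
but finitely many shapes forces \<open>n = 2 p\<close> and \<open>p\<^sup>2 = 3 q\<^sup>2\<close>, which are the four centers.\<close>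

section \<open>Points of the plane as complex numbers\<close>

definition pt :: "complex \<Rightarrow> point" where
  "pt z = vector [Re z, Im z]"

definition cx :: "point \<Rightarrow> complex" where
  "cx p = Complex (p $ 1) (p $ 2)"

lemma pt_nth [simp]: "pt z $ 1 = Re z" "pt z $ 2 = Im z"
  by (simp_all add: pt_def)

lemma cx_pt [simp]: "cx (pt z) = z"
  by (simp add: cx_def)

lemma pt_cx [simp]: "pt (cx p) = p"
  by (simp add: cx_def vec_eq_iff forall_2)

lemma pt_eq_iff [simp]: "pt z = pt w \<longleftrightarrow> z = w"
  by (metis cx_pt)

lemma linear_pt: "linear pt"
  by (rule linearI) (simp_all add: vec_eq_iff forall_2)

lemma linear_cx: "linear cx"
  by (rule linearI) (simp_all add: cx_def complex_eq_iff)

lemmas pt_linear =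
  linear_add[OF linear_pt] linear_diff[OF linear_pt] linear_scale[OF linear_pt]

lemma norm_pt [simp]: "norm (pt z) = cmod z"
  by (simp add: norm_vec_def L2_set_def sum_2 cmod_def)

lemma norm_cx [simp]: "cmod (cx p) = norm p"
  by (metis norm_pt pt_cx)

lemma dist_pt [simp]: "dist (pt z) (pt w) = cmod (z - w)"
  by (metis dist_norm norm_pt pt_linear(2))

lemma collinear_linear_image:
  fixes f :: "'a::euclidean_space \<Rightarrow> 'b::euclidean_space"
  assumes "linear f" "collinear S"
  shows "collinear (f ` S)"
  using aff_dim_linear_image_le[OF assms(1), of S] assms(2) by (simp add: collinear_aff_dim)

lemma collinear_pt_iff: "collinear (pt ` S) \<longleftrightarrow> collinear S"
  using collinear_linear_image[OF linear_pt, of S] collinear_linear_image[OF linear_cx, of "pt ` S"]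
  by (auto simp: image_image)

text \<open>The imaginary part is twice the signed area, up to sign.\<close>

lemma collinear_complex_iff:
  "collinear {a, b, c} \<longleftrightarrow> Im ((b - a) * cnj (c - a)) = 0" for a b c :: complex
proof -
  have "collinear {a, b, c} \<longleftrightarrow> collinear {b, a, c}"
    by (simp add: insert_commute)
  also have "\<dots> \<longleftrightarrow> collinear {0, b - a, c - a}"
    using collinear_3[of b a c] by (cases "b = 0") (auto simp: NO_MATCH_def)
  also have "\<dots> \<longleftrightarrow> (c - a) / (b - a) \<in> \<real>"
    by (rule collinear_iff_Reals)
  also have "\<dots> \<longleftrightarrow> Im ((c - a) / (b - a)) = 0"
    by (simp add: complex_is_Real_iff)
  also have "\<dots> \<longleftrightarrow> Im ((b - a) * cnj (c - a)) = 0"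
    by (cases "b = a") (auto simp: Im_divide complex_eq_iff algebra_simps)
  finally show ?thesis .
qed

section \<open>Triangles in Fourier coordinates\<close>

definition rot3 :: complex  ("\<omega>") where
  "\<omega> = Complex (- 1 / 2) (sqrt 3 / 2)"

lemma cnj_rot3: "cnj \<omega> = - 1 - \<omega>"
  by (simp add: rot3_def complex_eq_iff)

lemma rot3_sq: "\<omega> * \<omega> = - 1 - \<omega>"
  by (simp add: rot3_def complex_eq_iff)

lemma rot3_sq': "\<omega> * (\<omega> * x) = - x - \<omega> * x"
  by (simp add: mult.assoc[symmetric] rot3_sq) (simp add: algebra_simps)

lemmas rot3_simps = cnj_rot3 rot3_sq rot3_sq'

text \<open>The inverse discrete Fourier transform of the vertices; \<open>z0\<close> is the centroid, \<open>z1\<close> and \<open>z2\<close> span the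
positively and the negatively oriented equilateral part of the triangle.\<close>

definition tri :: "complex \<Rightarrow> complex \<Rightarrow> complex \<Rightarrow> triangle" where
  "tri z0 z1 z2 =
     (pt (z0 + z1 + z2), pt (z0 + \<omega> * z1 + cnj \<omega> * z2), pt (z0 + cnj \<omega> * z1 + \<omega> * z2))"

lemma tri_surj: obtains z0 z1 z2 where "\<Delta> = tri z0 z1 z2"
proof -
  obtain A B C where D: "\<Delta> = (pt A, pt B, pt C)"
    by (metis prod_cases3 pt_cx)
  define z0 where "z0 = (A + B + C) / 3"
  define z1 where "z1 = (A + cnj \<omega> * B + \<omega> * C) / 3"
  define z2 where "z2 = (A + \<omega> * B + cnj \<omega> * C) / 3"
  have "z0 + z1 + z2 = A"
    by (simp add: z0_def z1_def z2_def rot3_simps field_simps)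
  moreover have "z0 + \<omega> * z1 + cnj \<omega> * z2 = B"
    by (simp add: z0_def z1_def z2_def rot3_simps field_simps)
  moreover have "z0 + cnj \<omega> * z1 + \<omega> * z2 = C"
    by (simp add: z0_def z1_def z2_def rot3_simps field_simps)
  ultimately show ?thesis
    using D that[of z0 z1 z2] by (simp add: tri_def)
qed

lemma tri_in_triangles_iff: "tri z0 z1 z2 \<in> triangles \<longleftrightarrow> cmod z1 \<noteq> cmod z2"
proof -
  have "tri z0 z1 z2 \<in> triangles \<longleftrightarrow>
      \<not> collinear (pt ` {z0 + z1 + z2, z0 + \<omega> * z1 + cnj \<omega> * z2, z0 + cnj \<omega> * z1 + \<omega> * z2})"
    by (simp add: tri_def triangles_def)
  also have "\<dots> \<longleftrightarrow> 3 * sqrt 3 / 2 * ((cmod z2)\<^sup>2 - (cmod z1)\<^sup>2) \<noteq> 0"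
    unfolding collinear_pt_iff collinear_complex_iff
  proof -
    have "Im ((z0 + \<omega> * z1 + cnj \<omega> * z2 - (z0 + z1 + z2)) *
        cnj (z0 + cnj \<omega> * z1 + \<omega> * z2 - (z0 + z1 + z2))) =
        3 * sqrt 3 / 2 * ((cmod z2)\<^sup>2 - (cmod z1)\<^sup>2)"
      unfolding cmod_power2 by (simp add: rot3_def power2_eq_square) (simp add: field_simps)
    then show "(\<not> Im ((z0 + \<omega> * z1 + cnj \<omega> * z2 - (z0 + z1 + z2)) *
        cnj (z0 + cnj \<omega> * z1 + \<omega> * z2 - (z0 + z1 + z2))) = 0) \<longleftrightarrow>
        3 * sqrt 3 / 2 * ((cmod z2)\<^sup>2 - (cmod z1)\<^sup>2) \<noteq> 0"
      by metis
  qed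
  also have "\<dots> \<longleftrightarrow> cmod z1 \<noteq> cmod z2"
    by auto
  finally show ?thesis .
qed

lemma side_sq_tri:
  fixes z1 z2 :: complex
  defines "s \<equiv> (cmod z1)\<^sup>2 + (cmod z2)\<^sup>2"
  shows "(side_a (tri z0 z1 z2))\<^sup>2 = 3 * (s - 2 * Re (z1 * cnj z2))"
    and "(side_b (tri z0 z1 z2))\<^sup>2 = 3 * (s - 2 * Re (\<omega> * \<omega> * (z1 * cnj z2)))"
    and "(side_c (tri z0 z1 z2))\<^sup>2 = 3 * (s - 2 * Re (\<omega> * (z1 * cnj z2)))"
  unfolding s_def
  by (simp_all add: tri_def cmod_power2, simp_all add: rot3_def power2_eq_square)
    (simp_all add: algebra_simps)

text \<open>Power sums of the real parts of \<open>z\<close> and its two rotations by a third of a turn; they evaluate the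
symmetric functions of the squared side lengths.\<close>

lemma rot3_orbit_Re:
  "Re z + Re (\<omega> * \<omega> * z) + Re (\<omega> * z) = 0"
  "(Re z)\<^sup>2 + (Re (\<omega> * \<omega> * z))\<^sup>2 + (Re (\<omega> * z))\<^sup>2 = 3 / 2 * (cmod z)\<^sup>2"
   apply (simp add: rot3_def)
  apply (simp only: cmod_power2)
  apply (simp add: rot3_def power2_eq_square algebra_simps)
  done

lemma sum_side_powers_tri:
  fixes z0 z1 z2 :: complex
  defines "P \<equiv> (cmod z1)\<^sup>2" and "Q \<equiv> (cmod z2)\<^sup>2"
  defines "x \<equiv> (side_a (tri z0 z1 z2))\<^sup>2" and "y \<equiv> (side_b (tri z0 z1 z2))\<^sup>2"
    and "z \<equiv> (side_c (tri z0 z1 z2))\<^sup>2"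
  shows "x + y + z = 9 * (P + Q)"
    and "x\<^sup>2 + y\<^sup>2 + z\<^sup>2 = 27 * ((P + Q)\<^sup>2 + 2 * P * Q)"
proof -
  define r0 r1 r2 where "r0 = Re (z1 * cnj z2)" and "r1 = Re (\<omega> * \<omega> * (z1 * cnj z2))"
    and "r2 = Re (\<omega> * (z1 * cnj z2))"
  have xyz: "x = 3 * (P + Q - 2 * r0)" "y = 3 * (P + Q - 2 * r1)" "z = 3 * (P + Q - 2 * r2)"
    by (simp_all only: x_def y_def z_def side_sq_tri r0_def r1_def r2_def P_def Q_def)
  have 1: "r0 + r1 + r2 = 0"
    unfolding r0_def r1_def r2_def by (rule rot3_orbit_Re)
  have 2: "r0\<^sup>2 + r1\<^sup>2 + r2\<^sup>2 = 3 / 2 * (P * Q)"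
    unfolding r0_def r1_def r2_def rot3_orbit_Re
    by (simp add: P_def Q_def norm_mult power_mult_distrib)
  show "x + y + z = 9 * (P + Q)"
    using 1 by (simp add: xyz)
  have "x\<^sup>2 + y\<^sup>2 + z\<^sup>2 =
      27 * (P + Q)\<^sup>2 - 36 * (P + Q) * (r0 + r1 + r2) + 36 * (r0\<^sup>2 + r1\<^sup>2 + r2\<^sup>2)"
    unfolding xyz by algebra
  then show "x\<^sup>2 + y\<^sup>2 + z\<^sup>2 = 27 * ((P + Q)\<^sup>2 + 2 * P * Q)"
    by (simp add: 1 2)
qed

lemma area_tri:
  "area (side_a (tri z0 z1 z2)) (side_b (tri z0 z1 z2)) (side_c (tri z0 z1 z2)) =
     3 * sqrt 3 / 4 * \<bar>(cmod z1)\<^sup>2 - (cmod z2)\<^sup>2\<bar>"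
proof -
  define a b c where "a = side_a (tri z0 z1 z2)" and "b = side_b (tri z0 z1 z2)"
    and "c = side_c (tri z0 z1 z2)"
  define P Q where "P = (cmod z1)\<^sup>2" and "Q = (cmod z2)\<^sup>2"
  define s where "s = (a + b + c) / 2"
  have "16 * (s * (s - a) * (s - b) * (s - c)) =
      (a\<^sup>2 + b\<^sup>2 + c\<^sup>2)\<^sup>2 - 2 * ((a\<^sup>2)\<^sup>2 + (b\<^sup>2)\<^sup>2 + (c\<^sup>2)\<^sup>2)"
    unfolding s_def by (simp add: field_simps power2_eq_square)
  also have "\<dots> = 27 * (P - Q)\<^sup>2"
    using sum_side_powers_tri[of z0 z1 z2]
    by (simp add: a_def b_def c_def P_def Q_def power2_eq_square algebra_simps)
  finally have "s * (s - a) * (s - b) * (s - c) = (3 * sqrt 3 / 4 * \<bar>P - Q\<bar>)\<^sup>2"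
    by (simp add: power_mult_distrib power_divide)
  then show ?thesis
    by (simp add: area_def Let_def flip: a_def b_def c_def s_def P_def Q_def)
qed

lemma brocard_cot_tri:
  "brocard_cot (tri z0 z1 z2) =
     sqrt 3 * (((cmod z1)\<^sup>2 + (cmod z2)\<^sup>2) / \<bar>(cmod z1)\<^sup>2 - (cmod z2)\<^sup>2\<bar>)"
proof -
  have "9 * x / (4 * (3 * sqrt 3 / 4 * y)) = sqrt 3 * (x / y)" for x y :: real
  proof -
    have "9 * x / (4 * (3 * sqrt 3 / 4 * y)) = 9 / (3 * sqrt 3) * (x / y)"
      by simp
    also have "9 / (3 * sqrt 3) = sqrt (3 :: real)"
      by (simp add: real_div_sqrt)
    finally show ?thesis .
  qed
  then show ?thesis
    unfolding brocard_cot_def area_tri sum_side_powers_tri(1) .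
qed

text \<open>The sum of the squared differences of the squared sides is \<open>162 |z1|\<^sup>2 |z2|\<^sup>2\<close>, so the triangle is
equilateral exactly when one Fourier coefficient vanishes.\<close>

lemma base_triangles_tri_iff:
  "tri z0 z1 z2 \<in> base_triangles \<longleftrightarrow> cmod z1 \<noteq> cmod z2 \<and> z1 \<noteq> 0 \<and> z2 \<noteq> 0"
proof -
  define a b c where "a = side_a (tri z0 z1 z2)" and "b = side_b (tri z0 z1 z2)"
    and "c = side_c (tri z0 z1 z2)"
  define P Q where "P = (cmod z1)\<^sup>2" and "Q = (cmod z2)\<^sup>2"
  have pos: "a \<ge> 0" "b \<ge> 0" "c \<ge> 0"
    by (simp_all add: a_def b_def c_def tri_def)
  have eq: "(a\<^sup>2 - b\<^sup>2)\<^sup>2 + (b\<^sup>2 - c\<^sup>2)\<^sup>2 + (c\<^sup>2 - a\<^sup>2)\<^sup>2 =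
      3 * ((a\<^sup>2)\<^sup>2 + (b\<^sup>2)\<^sup>2 + (c\<^sup>2)\<^sup>2) - (a\<^sup>2 + b\<^sup>2 + c\<^sup>2)\<^sup>2"
    by algebra
  also have "\<dots> = 162 * (P * Q)"
    using sum_side_powers_tri[of z0 z1 z2]
    by (simp add: a_def b_def c_def P_def Q_def power2_eq_square algebra_simps)
  finally have eq: "(a\<^sup>2 - b\<^sup>2)\<^sup>2 + (b\<^sup>2 - c\<^sup>2)\<^sup>2 + (c\<^sup>2 - a\<^sup>2)\<^sup>2 = 162 * (P * Q)" .
  have "equilateral (tri z0 z1 z2) \<longleftrightarrow> a\<^sup>2 = b\<^sup>2 \<and> b\<^sup>2 = c\<^sup>2"
    using pos by (simp add: equilateral_def flip: a_def b_def c_def)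
  also have "\<dots> \<longleftrightarrow> (a\<^sup>2 - b\<^sup>2)\<^sup>2 + (b\<^sup>2 - c\<^sup>2)\<^sup>2 + (c\<^sup>2 - a\<^sup>2)\<^sup>2 = 0"
    by (auto simp: add_nonneg_eq_0_iff)
  also have "\<dots> \<longleftrightarrow> z1 = 0 \<or> z2 = 0"
    by (simp add: eq P_def Q_def)
  finally show ?thesis
    by (auto simp: base_triangles_def tri_in_triangles_iff)
qed

text \<open>The eigenvalue of the circulant matrix of the family on the first Fourier mode. The entries of the matrix
are real, so the eigenvalue on the second mode is the conjugate.\<close>

definition multiplier :: "(real \<Rightarrow> real ^ 3) \<Rightarrow> real \<Rightarrow> complex" where
  "multiplier \<Psi> t = (\<Psi> t $ 1 + \<omega> * \<Psi> t $ 2 + cnj \<omega> * \<Psi> t $ 3) / (\<Psi> t $ 1 + \<Psi> t $ 2 + \<Psi> t $ 3)"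

lemma barycentric_pt:
  "barycentric (pt A, pt B, pt C) u v w = pt ((u * A + v * B + w * C) / (u + v + w))"
  by (simp add: vec_eq_iff forall_2 add_divide_distrib)

lemma family_triangle_tri:
  assumes "triangle_family \<Psi>"
  shows "family_triangle \<Psi> (tri z0 z1 z2) t =
           tri z0 (multiplier \<Psi> t * z1) (cnj (multiplier \<Psi> t) * z2)"
proof -
  define u v w where "u = complex_of_real (\<Psi> t $ 1)" and "v = complex_of_real (\<Psi> t $ 2)"
    and "w = complex_of_real (\<Psi> t $ 3)"
  have cnjs: "cnj u = u" "cnj v = v" "cnj w = w"
    by (simp_all add: u_def v_def w_def)
  have "\<Psi> t $ 1 + \<Psi> t $ 2 + \<Psi> t $ 3 \<noteq> 0"
    using assms by (simp add: triangle_family_def)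
  then have S: "u + v + w \<noteq> 0"
    unfolding u_def v_def w_def by (metis of_real_add of_real_eq_0_iff)
  define S where "S = u + v + w"
  define M where "M = u + \<omega> * v + cnj \<omega> * w"
  have m: "multiplier \<Psi> t = M / S"
    by (simp add: multiplier_def u_def v_def w_def M_def S_def)
  have m': "cnj (multiplier \<Psi> t) = cnj M / S"
    by (simp add: m S_def cnjs)
  have sums: "w + u + v = S" "v + w + u = S" "S \<noteq> 0"
    using S by (simp_all add: S_def algebra_simps)
  have cnjS: "cnj S = S"
    by (simp add: S_def cnjs)
  have split: "(S * z0 + x) / S = z0 + x / S" for x
    using sums by (simp add: field_simps)
  have "(u * (z0 + z1 + z2) + v * (z0 + \<omega> * z1 + cnj \<omega> * z2) + w * (z0 + cnj \<omega> * z1 + \<omega> * z2)) =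
      S * z0 + (M * z1 + cnj M * z2)"
    "(w * (z0 + z1 + z2) + u * (z0 + \<omega> * z1 + cnj \<omega> * z2) + v * (z0 + cnj \<omega> * z1 + \<omega> * z2)) =
      S * z0 + (\<omega> * M * z1 + cnj \<omega> * cnj M * z2)"
    "(v * (z0 + z1 + z2) + w * (z0 + \<omega> * z1 + cnj \<omega> * z2) + u * (z0 + cnj \<omega> * z1 + \<omega> * z2)) =
      S * z0 + (cnj \<omega> * M * z1 + \<omega> * cnj M * z2)"
    by (simp_all add: S_def M_def cnjs rot3_simps algebra_simps)
  then show ?thesis
    unfolding family_triangle_def tri_def barycentric_pt prod.inject pt_eq_iff m m'
      u_def[symmetric] v_def[symmetric] w_def[symmetric] S_def[symmetric] sums
    using \<open>S \<noteq> 0\<close> by (simp add: split add_divide_distrib mult.assoc add.assoc cnjS)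
qed


section \<open>Centers that are quadratic in the side lengths\<close>

text \<open>A three-parameter family that contains all functions \<open>psi_Gamma\<close> and \<open>psi_Xi\<close>; the four
invariant centers are singled out among all of these by two equations in the parameters.\<close>

definition quad_fun :: "real \<Rightarrow> real \<Rightarrow> real \<Rightarrow> side_fun" where
  "quad_fun p q n = (\<lambda>a b c.
     Some (a * (p * (a\<^sup>2 + b\<^sup>2 + c\<^sup>2) + q * (4 * area a b c) - n * a\<^sup>2)))"

text \<open>The Boolean selects the reciprocal function, so that both kinds are treated together.\<close>

definition quad_center :: "bool \<Rightarrow> real \<Rightarrow> real \<Rightarrow> real \<Rightarrow> center" where
  "quad_center r p q n = center_of (if r then recip (quad_fun p q n) else quad_fun p q n)"

text \<open>The value of \<open>p (a\<^sup>2 + b\<^sup>2 + c\<^sup>2) + 4 q area\<close>, where \<open>P\<close> and \<open>Q\<close> are the squared moduli of the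
Fourier coefficients.\<close>

definition level :: "real \<Rightarrow> real \<Rightarrow> real \<Rightarrow> real \<Rightarrow> real" where
  "level p q P Q = 9 * p * (P + Q) + 3 * sqrt 3 * q * \<bar>P - Q\<bar>"

text \<open>With \<open>h\<close> this quantity and \<open>e = 3/2 n (P - Q)\<close>, the coefficients of the two covariants below become
the symmetric pair \<open>h + e\<close>, \<open>h - e\<close>, interchanged for the reciprocal function.\<close>

definition shifted_level :: "real \<Rightarrow> real \<Rightarrow> real \<Rightarrow> real \<Rightarrow> real \<Rightarrow> real" where
  "shifted_level p q n P Q = 9 / 2 * n * (P + Q) - level p q P Q"

definition denom :: "bool \<Rightarrow> real \<Rightarrow> real \<Rightarrow> real \<Rightarrow> real \<Rightarrow> real \<Rightarrow> real" where
  "denom r p q n P Q =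
     (if r then (shifted_level p q n P Q)\<^sup>2 - 3 * n * (P + Q) * shifted_level p q n P Q + (3 / 2 * n * (P - Q))\<^sup>2
      else 3 / 2 * n * (P - Q) * (P - Q) - (P + Q) * shifted_level p q n P Q)"

definition coefU :: "bool \<Rightarrow> real \<Rightarrow> real \<Rightarrow> real \<Rightarrow> real \<Rightarrow> real \<Rightarrow> real" where
  "coefU r p q n P Q =
     (if r then 3 * n * (shifted_level p q n P Q - 3 / 2 * n * (P - Q))
      else shifted_level p q n P Q + 3 / 2 * n * (P - Q)) / denom r p q n P Q"

definition coefV :: "bool \<Rightarrow> real \<Rightarrow> real \<Rightarrow> real \<Rightarrow> real \<Rightarrow> real \<Rightarrow> real" where
  "coefV r p q n P Q =
     (if r then 3 * n * (shifted_level p q n P Q + 3 / 2 * n * (P - Q))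
      else shifted_level p q n P Q - 3 / 2 * n * (P - Q)) / denom r p q n P Q"

text \<open>The two covariants from which the position of the center relative to the centroid is built. Up to real
factors they are \<open>z1\<^sup>2 / z2\<close> and \<open>z2\<^sup>2 / z1\<close>, whose negatives are the isodynamic points
relative to the centroid.\<close>

definition covU :: "complex \<Rightarrow> complex \<Rightarrow> complex" where
  "covU z1 z2 = z1\<^sup>2 * cnj z2"

definition covV :: "complex \<Rightarrow> complex \<Rightarrow> complex" where
  "covV z1 z2 = z2\<^sup>2 * cnj z1"

text \<open>Barycentric weights that are quadratic polynomials in the squared sides. The constant part contributes only
to the centroid; for the other two parts one expands the squared sides in Fourier coefficients, and only
the products whose frequency is divisible by three survive the sum over the vertices.\<close>

lemma quadratic_weights:
  fixes z0 z1 z2 :: complex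
  defines "P \<equiv> (cmod z1)\<^sup>2" and "Q \<equiv> (cmod z2)\<^sup>2"
  defines "x \<equiv> (side_a (tri z0 z1 z2))\<^sup>2" and "y \<equiv> (side_b (tri z0 z1 z2))\<^sup>2"
    and "z \<equiv> (side_c (tri z0 z1 z2))\<^sup>2"
  assumes "wx = k0 + k1 * x + k2 * x\<^sup>2" "wy = k0 + k1 * y + k2 * y\<^sup>2" "wz = k0 + k1 * z + k2 * z\<^sup>2"
  assumes "W = wx + wy + wz" "W \<noteq> 0"
  shows "(1 / W) *\<^sub>R (wx *\<^sub>R pt (z0 + z1 + z2) + wy *\<^sub>R pt (z0 + \<omega> * z1 + cnj \<omega> * z2) +
           wz *\<^sub>R pt (z0 + cnj \<omega> * z1 + \<omega> * z2)) =
         pt (z0 - of_real ((9 * k1 + 27 * k2 * (2 * P + Q)) / W) * covU z1 z2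
                - of_real ((9 * k1 + 27 * k2 * (P + 2 * Q)) / W) * covV z1 z2)"
proof -
  define y1 y2 where "y1 = cnj z1" and "y2 = cnj z2"
  define s where "s = z1 * y1 + z2 * y2"
  define c0 c1 c2 where "c0 = complex_of_real k0" and "c1 = complex_of_real k1"
    and "c2 = complex_of_real k2"
  have PQ: "complex_of_real P = z1 * y1" "complex_of_real Q = z2 * y2"
    by (simp_all only: P_def Q_def y1_def y2_def complex_norm_square)
  have X: "complex_of_real x = 3 * (s - z1 * y2 - z2 * y1)"
  proof -
    have "complex_of_real x = 3 * (of_real P + of_real Q - of_real (2 * Re (z1 * cnj z2)))"
      unfolding x_def side_sq_tri P_def Q_def by simp
    then show ?thesis
      unfolding PQ complex_add_cnj[symmetric] by (simp add: s_def y1_def y2_def algebra_simps)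
  qed
  have Y: "complex_of_real y = 3 * (s + z1 * y2 + \<omega> * z1 * y2 - \<omega> * z2 * y1)"
  proof -
    have "complex_of_real y = 3 * (of_real P + of_real Q - of_real (2 * Re (\<omega> * \<omega> * (z1 * cnj z2))))"
      unfolding y_def side_sq_tri P_def Q_def by simp
    then show ?thesis
      unfolding PQ complex_add_cnj[symmetric]
      by (simp add: s_def y1_def y2_def rot3_simps algebra_simps)
  qed
  have Z: "complex_of_real z = 3 * (s - \<omega> * z1 * y2 + z2 * y1 + \<omega> * z2 * y1)"
  proof -
    have "complex_of_real z = 3 * (of_real P + of_real Q - of_real (2 * Re (\<omega> * (z1 * cnj z2))))"
      unfolding z_def side_sq_tri P_def Q_def by simp
    then show ?thesis
      unfolding PQ complex_add_cnj[symmetric]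
      by (simp add: s_def y1_def y2_def rot3_simps algebra_simps)
  qed
  define A B C where "A = z0 + z1 + z2" and "B = z0 + \<omega> * z1 + cnj \<omega> * z2"
    and "C = z0 + cnj \<omega> * z1 + \<omega> * z2"
  have 0: "A + B + C = 3 * z0"
    by (simp add: A_def B_def C_def rot3_simps algebra_simps)
  have 1: "of_real x * A + of_real y * B + of_real z * C =
      9 * s * z0 - 9 * (z1\<^sup>2 * y2 + z2\<^sup>2 * y1)"
    unfolding X Y Z A_def B_def C_def
    by (simp add: rot3_simps algebra_simps power2_eq_square)
  have 2: "of_real x ^ 2 * A + of_real y ^ 2 * B + of_real z ^ 2 * C =
      27 * (s\<^sup>2 + 2 * (z1 * y1) * (z2 * y2)) * z0
      - 27 * ((2 * z1 * y1 + z2 * y2) * (z1\<^sup>2 * y2) + (z1 * y1 + 2 * z2 * y2) * (z2\<^sup>2 * y1))"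
    unfolding X Y Z A_def B_def C_def s_def
    by (simp add: rot3_simps algebra_simps power2_eq_square)
  have W: "W = 3 * k0 + k1 * (9 * (P + Q)) + k2 * (27 * ((P + Q)\<^sup>2 + 2 * P * Q))"
    using sum_side_powers_tri[of z0 z1 z2, folded x_def y_def z_def P_def Q_def]
    unfolding assms(6-9) by algebra
  have "of_real wx * A + of_real wy * B + of_real wz * C =
      c0 * (A + B + C) + c1 * (of_real x * A + of_real y * B + of_real z * C)
      + c2 * (of_real x ^ 2 * A + of_real y ^ 2 * B + of_real z ^ 2 * C)"
    unfolding assms(6-8) c0_def c1_def c2_def by (simp add: algebra_simps)
  also have "\<dots> = of_real W * z0
      - of_real (9 * k1 + 27 * k2 * (2 * P + Q)) * covU z1 z2
      - of_real (9 * k1 + 27 * k2 * (P + 2 * Q)) * covV z1 z2"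
    unfolding 0 1 2 W of_real_add of_real_mult of_real_power of_real_numeral PQ
      c0_def[symmetric] c1_def[symmetric] c2_def[symmetric]
    by (simp add: s_def covU_def covV_def y1_def y2_def algebra_simps)
  finally have N: "of_real wx * A + of_real wy * B + of_real wz * C = \<dots>" .
  have "(1 / W) *\<^sub>R (wx *\<^sub>R pt A + wy *\<^sub>R pt B + wz *\<^sub>R pt C) =
      pt ((of_real wx * A + of_real wy * B + of_real wz * C) / of_real W)"
    by (simp add: pt_linear[symmetric] scaleR_conv_of_real[symmetric])
      (simp add: scaleR_conv_of_real divide_inverse mult.commute)
  also have "\<dots> = pt (z0 - of_real ((9 * k1 + 27 * k2 * (2 * P + Q)) / W) * covU z1 z2
                - of_real ((9 * k1 + 27 * k2 * (P + 2 * Q)) / W) * covV z1 z2)"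
    unfolding N using assms(10) by (simp add: field_simps)
  finally show ?thesis
    unfolding A_def B_def C_def .
qed

lemma area_cyclic: "area b c a = area a b c" "area c a b = area a b c"
  by (simp_all add: area_def Let_def algebra_simps)

text \<open>For the function itself the weights are \<open>x (m - n x)\<close> in the squared side \<open>x\<close>. For the reciprocal
they are \<open>1 / (m - n x)\<close>; multiplying by all three denominators turns them into products of two factors
such as \<open>(m - n y) (m - n z)\<close>, and these are again quadratic in \<open>x\<close>, because \<open>y + z\<close> and \<open>y z\<close>
are expressible by \<open>x\<close> and the elementary symmetric functions. The center fails to exist
if the weights sum to zero or one of the reciprocals is undefined.\<close>

lemma quad_center_tri:
  fixes z0 z1 z2 :: complex
  defines "P \<equiv> (cmod z1)\<^sup>2" and "Q \<equiv> (cmod z2)\<^sup>2"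
  assumes nondeg: "cmod z1 \<noteq> cmod z2"
  shows "quad_center r p q n (tri z0 z1 z2) =
    (if denom r p q n P Q = 0 \<or>
        r \<and> (\<exists>x\<in>{side_a (tri z0 z1 z2), side_b (tri z0 z1 z2), side_c (tri z0 z1 z2)}.
               level p q P Q = n * x\<^sup>2)
     then None
     else Some (pt (z0 + of_real (coefU r p q n P Q) * covU z1 z2
                       + of_real (coefV r p q n P Q) * covV z1 z2)))"
proof -
  define a b c where abc: "a = side_a (tri z0 z1 z2)" "b = side_b (tri z0 z1 z2)"
    "c = side_c (tri z0 z1 z2)"
  define m where "m = level p q P Q"
  define h where "h = shifted_level p q n P Q"
  define A B C where "A = pt (z0 + z1 + z2)" and "B = pt (z0 + \<omega> * z1 + cnj \<omega> * z2)"
    and "C = pt (z0 + cnj \<omega> * z1 + \<omega> * z2)"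
  have ABC: "tri z0 z1 z2 = (A, B, C)"
    by (simp add: tri_def A_def B_def C_def)
  have in_tri: "(A, B, C) \<in> triangles"
    using nondeg tri_in_triangles_iff[of z0 z1 z2] by (simp add: ABC)
  have dists: "dist B C = a" "dist C A = b" "dist A B = c"
    by (simp_all add: abc ABC)
  have pos: "a > 0" "b > 0" "c > 0"
    using in_tri by (auto simp: dists[symmetric] triangles_def insert_commute)
  note sums = sum_side_powers_tri[of z0 z1 z2, folded abc P_def Q_def]
  have "p * (a\<^sup>2 + b\<^sup>2 + c\<^sup>2) + q * (4 * area a b c) = m"
    using sums(1) area_tri[of z0 z1 z2, folded abc P_def Q_def]
    by (simp add: m_def level_def algebra_simps)
  then have m: "p * (a\<^sup>2 + b\<^sup>2 + c\<^sup>2) + q * (4 * area a b c) = m"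
    "p * (b\<^sup>2 + c\<^sup>2 + a\<^sup>2) + q * (4 * area b c a) = m"
    "p * (c\<^sup>2 + a\<^sup>2 + b\<^sup>2) + q * (4 * area c a b) = m"
    by (simp_all add: area_cyclic add_ac)
  have h: "h = 9 / 2 * n * (P + Q) - m"
    by (simp add: h_def shifted_level_def m_def)
  define x y z where xyz: "x = a\<^sup>2" "y = b\<^sup>2" "z = c\<^sup>2"
  have sum1: "x + y + z = 9 * (P + Q)" and sum2: "x\<^sup>2 + y\<^sup>2 + z\<^sup>2 = 27 * ((P + Q)\<^sup>2 + 2 * P * Q)"
    using sums by (simp_all add: xyz)
  have weights: "(1 / W) *\<^sub>R (wx *\<^sub>R A + wy *\<^sub>R B + wz *\<^sub>R C) =
         pt (z0 + of_real u * covU z1 z2 + of_real v * covV z1 z2)"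
    if "wx = k0 + k1 * x + k2 * x\<^sup>2" "wy = k0 + k1 * y + k2 * y\<^sup>2" "wz = k0 + k1 * z + k2 * z\<^sup>2"
      "W = wx + wy + wz" "W \<noteq> 0"
      "- ((9 * k1 + 27 * k2 * (2 * P + Q)) / W) = u"
      "- ((9 * k1 + 27 * k2 * (P + 2 * Q)) / W) = v" for W wx wy wz k0 k1 k2 u v
  proof -
    have "(1 / W) *\<^sub>R (wx *\<^sub>R A + wy *\<^sub>R B + wz *\<^sub>R C) =
         pt (z0 - of_real ((9 * k1 + 27 * k2 * (2 * P + Q)) / W) * covU z1 z2
                - of_real ((9 * k1 + 27 * k2 * (P + 2 * Q)) / W) * covV z1 z2)"
      using quadratic_weights[of wx k0 k1 z0 z1 z2 k2 wy wz W] that(1-5)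
      unfolding A_def B_def C_def P_def Q_def xyz abc by simp
    then show ?thesis
      by (simp only: that(6,7)[symmetric] of_real_minus) simp
  qed
  show ?thesis
  proof (cases r)
    case False
    define W where "W = x * (m - n * x) + y * (m - n * y) + z * (m - n * z)"
    have "W = m * (x + y + z) - n * (x\<^sup>2 + y\<^sup>2 + z\<^sup>2)"
      by (simp add: W_def algebra_simps power2_eq_square)
    also have "\<dots> = 9 * denom r p q n P Q"
      using False by (simp add: sum1 sum2 denom_def h flip: h_def)
        (simp add: field_simps power2_eq_square)
    finally have W: "W = 9 * denom r p q n P Q" .
    have weighted: "(1 / W) *\<^sub>R ((x * (m - n * x)) *\<^sub>R A + (y * (m - n * y)) *\<^sub>R B + (z * (m - n * z)) *\<^sub>R C) =
        pt (z0 + of_real (coefU r p q n P Q) * covU z1 z2 + of_real (coefV r p q n P Q) * covV z1 z2)"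
      if "W \<noteq> 0"
    proof -
      have "- ((9 * m + 27 * (- n) * (2 * P + Q)) / W) = coefU r p q n P Q"
        "- ((9 * m + 27 * (- n) * (P + 2 * Q)) / W) = coefV r p q n P Q"
        using False that
        by (simp_all add: W coefU_def coefV_def h flip: h_def) (simp_all add: field_simps)
      moreover have "u * (m - n * u) = 0 + m * u + - n * u\<^sup>2" for u
        by (simp add: algebra_simps power2_eq_square)
      ultimately show ?thesis
        by (intro weights[OF _ _ _ W_def that])
    qed
    show ?thesis
    proof (cases "W = 0")
      case True
      then have "a * (a * (m - n * a\<^sup>2)) + b * (b * (m - n * b\<^sup>2)) + c * (c * (m - n * c\<^sup>2)) = 0"
        by (simp add: W_def xyz power2_eq_square algebra_simps)
      then have "quad_center r p q n (tri z0 z1 z2) = None"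
        using False by (simp add: quad_center_def ABC dists Let_def quad_fun_def m)
      moreover have "denom r p q n P Q = 0"
        using W True by simp
      ultimately show ?thesis
        using False by simp
    next
      case W0: False
      have sq: "a * (a * (m - n * a\<^sup>2)) = x * (m - n * x)" "b * (b * (m - n * b\<^sup>2)) = y * (m - n * y)"
        "c * (c * (m - n * c\<^sup>2)) = z * (m - n * z)"
        by (simp_all add: xyz power2_eq_square)
      have "quad_center r p q n (tri z0 z1 z2) =
         Some ((1 / W) *\<^sub>R ((x * (m - n * x)) *\<^sub>R A + (y * (m - n * y)) *\<^sub>R B + (z * (m - n * z)) *\<^sub>R C))"
        using False W0 by (simp add: quad_center_def ABC dists Let_def quad_fun_def m sq in_tri flip: W_def)
      then show ?thesis
        using False W0 W weighted by simp
    qed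
  next
    case True
    define X Y Z where XYZ: "X = m - n * x" "Y = m - n * y" "Z = m - n * z"
    show ?thesis
    proof (cases "X * Y * Z = 0")
      case zero: True
      then have "\<exists>x\<in>{a, b, c}. m = n * x\<^sup>2"
        by (auto simp: XYZ xyz)
      moreover have "quad_center r p q n (tri z0 z1 z2) = None"
        using True zero
        by (auto simp: quad_center_def ABC dists Let_def quad_fun_def recip_def m XYZ xyz
            split: option.splits)
      ultimately show ?thesis
        using True by (simp flip: abc m_def)
    next
      case nonzero: False
      then have no: "\<not> (\<exists>x\<in>{a, b, c}. m = n * x\<^sup>2)"
        by (auto simp: XYZ xyz)
      define W where "W = Y * Z + Z * X + X * Y"
      define k0 where "k0 = m\<^sup>2 - 9 * m * n * (P + Q) + 27 * n\<^sup>2 * ((P + Q)\<^sup>2 - P * Q)"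
      define k1 where "k1 = n * m - 9 * n\<^sup>2 * (P + Q)"
      have e2: "x * y + y * z + z * x = 27 * ((P + Q)\<^sup>2 - P * Q)"
      proof -
        have "2 * (x * y + y * z + z * x) = (x + y + z)\<^sup>2 - (x\<^sup>2 + y\<^sup>2 + z\<^sup>2)"
          by algebra
        then show ?thesis
          unfolding sum1 sum2 by algebra
      qed
      have w: "Y * Z = k0 + k1 * x + n\<^sup>2 * x\<^sup>2" "Z * X = k0 + k1 * y + n\<^sup>2 * y\<^sup>2"
        "X * Y = k0 + k1 * z + n\<^sup>2 * z\<^sup>2"
        using sum1 e2 unfolding XYZ k0_def k1_def by algebra+
      have "W = 3 * k0 + k1 * (x + y + z) + n\<^sup>2 * (x\<^sup>2 + y\<^sup>2 + z\<^sup>2)"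
        unfolding W_def w by (simp add: algebra_simps)
      also have "\<dots> = 3 * denom r p q n P Q"
        unfolding sum1 sum2 k0_def k1_def using True
        by (simp add: denom_def h flip: h_def) (simp add: field_simps power2_eq_square)
      finally have W: "W = 3 * denom r p q n P Q" .
      have weighted: "(1 / W) *\<^sub>R ((Y * Z) *\<^sub>R A + (Z * X) *\<^sub>R B + (X * Y) *\<^sub>R C) =
          pt (z0 + of_real (coefU r p q n P Q) * covU z1 z2 + of_real (coefV r p q n P Q) * covV z1 z2)"
        if "W \<noteq> 0"
      proof -
        have "- ((9 * k1 + 27 * n\<^sup>2 * (2 * P + Q)) / W) = coefU r p q n P Q"
          "- ((9 * k1 + 27 * n\<^sup>2 * (P + 2 * Q)) / W) = coefV r p q n P Q"
          using True that
          by (simp_all add: W coefU_def coefV_def k1_def h flip: h_def)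
            (simp_all add: field_simps power2_eq_square)
        then show ?thesis
          by (rule weights[OF w W_def that])
      qed
      have inv: "a * (1 / (a * (m - n * a\<^sup>2))) = Y * Z / (X * Y * Z)"
        "b * (1 / (b * (m - n * b\<^sup>2))) = Z * X / (X * Y * Z)"
        "c * (1 / (c * (m - n * c\<^sup>2))) = X * Y / (X * Y * Z)"
        using pos nonzero by (simp_all add: XYZ xyz)
      have inv_sum: "Y * Z / (X * Y * Z) + Z * X / (X * Y * Z) + X * Y / (X * Y * Z) = W / (X * Y * Z)"
        by (simp add: W_def add_divide_distrib)
      have some: "recip (quad_fun p q n) a b c = Some (1 / (a * (m - n * a\<^sup>2)))"
        "recip (quad_fun p q n) b c a = Some (1 / (b * (m - n * b\<^sup>2)))"
        "recip (quad_fun p q n) c a b = Some (1 / (c * (m - n * c\<^sup>2)))"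
        using no pos by (auto simp: recip_def quad_fun_def m)
      have "quad_center r p q n (tri z0 z1 z2) = (if W = 0 then None else
         Some ((1 / (W / (X * Y * Z))) *\<^sub>R ((Y * Z / (X * Y * Z)) *\<^sub>R A
           + (Z * X / (X * Y * Z)) *\<^sub>R B + (X * Y / (X * Y * Z)) *\<^sub>R C)))"
      proof -
        have "quad_center r p q n (tri z0 z1 z2) = center_of (recip (quad_fun p q n)) (A, B, C)"
          using True by (simp add: quad_center_def ABC)
        then show ?thesis
          using in_tri nonzero
          by (simp only: center_of.simps dists Let_def some option.case prod.case inv inv_sum) simp
      qed
      also have "(1 / (W / (X * Y * Z))) *\<^sub>R ((Y * Z / (X * Y * Z)) *\<^sub>R A
           + (Z * X / (X * Y * Z)) *\<^sub>R B + (X * Y / (X * Y * Z)) *\<^sub>R C) =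
          (1 / W) *\<^sub>R ((Y * Z) *\<^sub>R A + (Z * X) *\<^sub>R B + (X * Y) *\<^sub>R C)"
        using nonzero by (simp add: scaleR_add_right)
      finally show ?thesis
        using True W weighted no by (simp flip: abc m_def)
    qed
  qed
qed


section \<open>The curve of a center in a triangle family\<close>

lemma quad_center_degenerate:
  assumes "cmod z1 = cmod z2"
  shows "quad_center r p q n (tri z0 z1 z2) = None"
proof -
  have "tri z0 z1 z2 \<notin> triangles"
    using assms by (simp add: tri_in_triangles_iff)
  then have "center_of \<psi> (tri z0 z1 z2) = None" for \<psi>
    by (auto simp: tri_def Let_def split: option.splits)
  then show ?thesis
    by (simp add: quad_center_def)
qed

text \<open>On the unit circle \<open>cnj E = 1 / E\<close>, so the equation is polynomial in \<open>E\<close> with leading coefficient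
\<open>c\<close>.\<close>

lemma finite_unit_circle_Re:
  fixes c :: complex
  assumes "c \<noteq> 0" "k > 0"
  shows "finite {E. cmod E = 1 \<and> Re (c * E ^ k) = x}"
proof -
  define f where "f = monom c (2 * k) - monom (2 * of_real x) k + [:cnj c:]"
  have "coeff f (2 * k) = c"
    using assms(2) by (simp add: f_def coeff_pCons split: nat.split)
  then have "f \<noteq> 0"
    using assms(1) by auto
  then have fin: "finite {E. poly f E = 0}"
    by (rule poly_roots_finite)
  have "poly f E = 0" if "cmod E = 1" "Re (c * E ^ k) = x" for E
  proof -
    define F where "F = E ^ k"
    have "cmod F = 1"
      using that(1) by (simp add: F_def norm_power)
    then have unit: "F * cnj F = 1"
      using complex_norm_square[of F] by simp
    have "E ^ (2 * k) = F * F"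
      unfolding F_def mult_2 power_add by (rule refl)
    then have "poly f E = c * (F * F) - 2 * of_real x * F + cnj c"
      unfolding f_def poly_add poly_diff poly_monom by (simp add: F_def)
    moreover have "F * (c * F + cnj (c * F) - 2 * of_real x) =
        c * (F * F) - 2 * of_real x * F + cnj c * (F * cnj F)"
      unfolding complex_cnj_mult by (simp only: algebra_simps)
    ultimately have "poly f E = F * (c * F + cnj (c * F) - 2 * of_real x)"
      by (simp only: unit mult_1_right)
    also have "c * F + cnj (c * F) = 2 * of_real x"
      using that(2) unfolding complex_add_cnj F_def by simp
    finally show ?thesis
      by simp
  qed
  then show ?thesis
    by (intro finite_subset[OF _ fin]) auto
qed

definition lin_coeff :: "bool \<Rightarrow> real \<Rightarrow> real \<Rightarrow> real \<Rightarrow> complex \<Rightarrow> complex \<Rightarrow> complex" where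
  "lin_coeff r p q n z1 z2 = of_real (coefU r p q n ((cmod z1)\<^sup>2) ((cmod z2)\<^sup>2)) * covU z1 z2"

definition conj_coeff :: "bool \<Rightarrow> real \<Rightarrow> real \<Rightarrow> real \<Rightarrow> complex \<Rightarrow> complex \<Rightarrow> complex" where
  "conj_coeff r p q n z1 z2 = of_real (coefV r p q n ((cmod z1)\<^sup>2) ((cmod z2)\<^sup>2)) * covV z1 z2"

text \<open>The universal curve at the multiplier \<open>\<mu>\<close>: the factor by which \<open>u U\<close> grows under the twist, namely
\<open>\<mu>\<^sup>3\<close> from \<open>U\<close> divided by \<open>|\<mu>|\<^sup>2\<close> from the homogeneous coefficient.\<close>

definition model_point :: "complex \<Rightarrow> complex" where
  "model_point \<mu> = \<mu>\<^sup>2 / cnj \<mu>"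

text \<open>The phases \<open>\<mu> / cnj \<mu>\<close> at which one of the three reciprocals is undefined; the values of \<open>\<nu>\<close>
belong to the three sides.\<close>

definition undefined_phases :: "real \<Rightarrow> real \<Rightarrow> real \<Rightarrow> complex \<Rightarrow> complex \<Rightarrow> complex set" where
  "undefined_phases p q n z1 z2 = {E. cmod E = 1 \<and> (\<exists>\<nu>\<in>{1, \<omega> * \<omega>, \<omega>}.
     level p q ((cmod z1)\<^sup>2) ((cmod z2)\<^sup>2) =
       n * (3 * ((cmod z1)\<^sup>2 + (cmod z2)\<^sup>2 - 2 * Re (\<nu> * z1 * cnj z2 * E))))}"

lemma level_scale:
  assumes "c \<ge> 0"
  shows "level p q (c * P) (c * Q) = c * level p q P Q"
proof -
  have "\<bar>c * P - c * Q\<bar> = c * \<bar>P - Q\<bar>"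
    using assms by (simp add: abs_mult flip: right_diff_distrib)
  then show ?thesis
    by (simp add: level_def algebra_simps)
qed

lemma shifted_level_scale: "c \<ge> 0 \<Longrightarrow> shifted_level p q n (c * P) (c * Q) = c * shifted_level p q n P Q"
  by (simp add: shifted_level_def level_scale) (simp add: algebra_simps)

lemma denom_scale: "c \<ge> 0 \<Longrightarrow> denom r p q n (c * P) (c * Q) = c\<^sup>2 * denom r p q n P Q"
  by (simp add: denom_def shifted_level_scale) (simp add: power2_eq_square field_simps)

lemma coef_scale:
  assumes "c > 0"
  shows "coefU r p q n (c * P) (c * Q) = coefU r p q n P Q / c"
    and "coefV r p q n (c * P) (c * Q) = coefV r p q n P Q / c"
proof -
  have "3 * n * (c * h - 3 / 2 * n * (c * P - c * Q)) = c * (3 * n * (h - 3 / 2 * n * (P - Q)))"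
    "3 * n * (c * h + 3 / 2 * n * (c * P - c * Q)) = c * (3 * n * (h + 3 / 2 * n * (P - Q)))"
    "c * h - 3 / 2 * n * (c * P - c * Q) = c * (h - 3 / 2 * n * (P - Q))"
    "c * h + 3 / 2 * n * (c * P - c * Q) = c * (h + 3 / 2 * n * (P - Q))" for h
    by (simp_all add: algebra_simps)
  moreover have "c * x / (c\<^sup>2 * y) = x / y / c" for x y
    using assms by (simp add: power2_eq_square)
  ultimately show "coefU r p q n (c * P) (c * Q) = coefU r p q n P Q / c"
    "coefV r p q n (c * P) (c * Q) = coefV r p q n P Q / c"
    using assms by (cases r; simp only: coefU_def coefV_def shifted_level_scale denom_scale less_imp_le if_True
        if_False)+
qed

lemma coeffs_twist:
  assumes "\<mu> \<noteq> 0"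
  shows "lin_coeff r p q n (\<mu> * z1) (cnj \<mu> * z2) = lin_coeff r p q n z1 z2 * model_point \<mu>"
    and "conj_coeff r p q n (\<mu> * z1) (cnj \<mu> * z2) = conj_coeff r p q n z1 z2 * cnj (model_point \<mu>)"
proof -
  have pos: "(cmod \<mu>)\<^sup>2 > 0"
    using assms by simp
  have sq: "complex_of_real ((cmod \<mu>)\<^sup>2) = \<mu> * cnj \<mu>"
    by (rule complex_norm_square)
  show "lin_coeff r p q n (\<mu> * z1) (cnj \<mu> * z2) = lin_coeff r p q n z1 z2 * model_point \<mu>"
    using assms unfolding lin_coeff_def norm_mult power_mult_distrib complex_mod_cnj coef_scale[OF pos]
    by (simp only: of_real_divide sq covU_def model_point_def) (simp add: power2_eq_square)
  show "conj_coeff r p q n (\<mu> * z1) (cnj \<mu> * z2) = conj_coeff r p q n z1 z2 * cnj (model_point \<mu>)"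
    using assms unfolding conj_coeff_def norm_mult power_mult_distrib complex_mod_cnj coef_scale[OF pos]
    by (simp only: of_real_divide sq covV_def model_point_def) (simp add: power2_eq_square)
qed

lemma undefined_phases_iff:
  assumes "\<mu> \<noteq> 0"
  shows "\<mu> / cnj \<mu> \<in> undefined_phases p q n z1 z2 \<longleftrightarrow>
    (\<exists>x\<in>{side_a (tri z0 (\<mu> * z1) (cnj \<mu> * z2)), side_b (tri z0 (\<mu> * z1) (cnj \<mu> * z2)),
         side_c (tri z0 (\<mu> * z1) (cnj \<mu> * z2))}.
      level p q ((cmod (\<mu> * z1))\<^sup>2) ((cmod (cnj \<mu> * z2))\<^sup>2) = n * x\<^sup>2)"
proof -
  define c where "c = (cmod \<mu>)\<^sup>2"
  define P Q where "P = (cmod z1)\<^sup>2" and "Q = (cmod z2)\<^sup>2"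
  have c: "c > 0"
    using assms by (simp add: c_def)
  have PQ: "(cmod (\<mu> * z1))\<^sup>2 = c * P" "(cmod (cnj \<mu> * z2))\<^sup>2 = c * Q"
    by (simp_all add: norm_mult power_mult_distrib c_def P_def Q_def)
  have key: "level p q (c * P) (c * Q) =
        n * (3 * (c * P + c * Q - 2 * Re (\<nu> * (\<mu> * z1 * cnj (cnj \<mu> * z2))))) \<longleftrightarrow>
      level p q P Q = n * (3 * (P + Q - 2 * Re (\<nu> * z1 * cnj z2 * (\<mu> / cnj \<mu>))))" for \<nu>
  proof -
    have "complex_of_real c = \<mu> * cnj \<mu>"
      unfolding c_def by (rule complex_norm_square)
    then have "\<nu> * (\<mu> * z1 * cnj (cnj \<mu> * z2)) = of_real c * (\<nu> * z1 * cnj z2 * (\<mu> / cnj \<mu>))"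
      using assms by simp
    moreover have "Re (of_real c * X) = c * Re X" for X
      by simp
    ultimately have "Re (\<nu> * (\<mu> * z1 * cnj (cnj \<mu> * z2))) = c * Re (\<nu> * z1 * cnj z2 * (\<mu> / cnj \<mu>))"
      by (simp only:)
    moreover have "n * (3 * (c * P + c * Q - 2 * (c * x))) = c * (n * (3 * (P + Q - 2 * x)))" for x
      by (simp add: algebra_simps)
    ultimately show ?thesis
      using c by (simp only: level_scale less_imp_le) simp
  qed
  have "cmod (\<mu> / cnj \<mu>) = 1"
    using assms by (simp add: norm_divide)
  then have "\<mu> / cnj \<mu> \<in> undefined_phases p q n z1 z2 \<longleftrightarrow>
      (\<exists>\<nu>\<in>{1, \<omega> * \<omega>, \<omega>}. level p q (c * P) (c * Q) =
        n * (3 * (c * P + c * Q - 2 * Re (\<nu> * (\<mu> * z1 * cnj (cnj \<mu> * z2))))))"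
    unfolding key by (simp only: undefined_phases_def P_def Q_def mem_Collect_eq power2_eq_square simp_thms)
  then show ?thesis
    by (simp only: bex_simps insert_iff side_sq_tri PQ mult_1_left)
qed

lemma triangle_curve_quad_center:
  assumes "triangle_family \<Psi>" "cmod z1 \<noteq> cmod z2"
  defines "\<mu> \<equiv> multiplier \<Psi>"
  shows "triangle_curve (quad_center r p q n) \<Psi> (tri z0 z1 z2) t =
    (if \<mu> t = 0 \<or> denom r p q n ((cmod z1)\<^sup>2) ((cmod z2)\<^sup>2) = 0 \<or>
        r \<and> \<mu> t / cnj (\<mu> t) \<in> undefined_phases p q n z1 z2
     then None
     else Some (pt (z0 + lin_coeff r p q n z1 z2 * model_point (\<mu> t)
                       + conj_coeff r p q n z1 z2 * cnj (model_point (\<mu> t)))))"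
proof (cases "\<mu> t = 0")
  case True
  then show ?thesis
    using assms(1) by (simp add: triangle_curve_def family_triangle_tri quad_center_degenerate \<mu>_def)
next
  case False
  have nd: "cmod (\<mu> t * z1) \<noteq> cmod (cnj (\<mu> t) * z2)"
    using False assms(2) by (simp add: norm_mult)
  have "denom r p q n ((cmod (\<mu> t * z1))\<^sup>2) ((cmod (cnj (\<mu> t) * z2))\<^sup>2) = 0 \<longleftrightarrow>
      denom r p q n ((cmod z1)\<^sup>2) ((cmod z2)\<^sup>2) = 0"
    using False by (simp add: norm_mult power_mult_distrib denom_scale)
  moreover have "triangle_curve (quad_center r p q n) \<Psi> (tri z0 z1 z2) t =
      quad_center r p q n (tri z0 (\<mu> t * z1) (cnj (\<mu> t) * z2))"
    using assms(1) by (simp add: triangle_curve_def family_triangle_tri \<mu>_def)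
  ultimately show ?thesis
    using False
    unfolding quad_center_tri[OF nd] undefined_phases_iff[OF False, of p q n z1 z2 z0]
      coeffs_twist[OF False, symmetric] lin_coeff_def[symmetric] conj_coeff_def[symmetric]
    by simp
qed

text \<open>For \<open>n \<noteq> 0\<close> each side excludes at most two phases. For \<open>n = 0\<close> the excluded set is empty, since the level is then
nonzero whenever the denominator is.\<close>

lemma finite_undefined_phases:
  assumes "z1 \<noteq> 0" "z2 \<noteq> 0" "denom True p q n ((cmod z1)\<^sup>2) ((cmod z2)\<^sup>2) \<noteq> 0"
  shows "finite (undefined_phases p q n z1 z2)"
proof (cases "n = 0")
  case True
  then have "level p q ((cmod z1)\<^sup>2) ((cmod z2)\<^sup>2) \<noteq> 0"
    using assms(3) by (auto simp: denom_def shifted_level_def)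
  then show ?thesis
    using True by (simp add: undefined_phases_def)
next
  case False
  define s where "s = (cmod z1)\<^sup>2 + (cmod z2)\<^sup>2"
  define x where "x = (s - level p q ((cmod z1)\<^sup>2) ((cmod z2)\<^sup>2) / (3 * n)) / 2"
  have "undefined_phases p q n z1 z2 \<subseteq>
      (\<Union>\<nu>\<in>{1, \<omega> * \<omega>, \<omega>}. {E. cmod E = 1 \<and> Re ((\<nu> * z1 * cnj z2) * E ^ 1) = x})"
    using False by (auto simp: undefined_phases_def x_def s_def field_simps)
  moreover have "\<omega> \<noteq> 0"
    by (simp add: rot3_def complex_eq_iff)
  then have "finite {E. cmod E = 1 \<and> Re ((\<nu> * z1 * cnj z2) * E ^ 1) = x}"
    if "\<nu> \<in> {1, \<omega> * \<omega>, \<omega>}" for \<nu>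
    using that assms(1,2) by (intro finite_unit_circle_Re) auto
  ultimately show ?thesis
    by (meson finite.simps finite_UN_I finite_subset)
qed


section \<open>Real affine maps in complex form\<close>

text \<open>The maps \<open>z \<mapsto> z0 + \<alpha> z + \<beta> cnj z\<close> are exactly the real affine maps of the
complex plane; the moduli of \<open>\<alpha>\<close> and \<open>\<beta>\<close> decide whether such a map is
invertible, and it is a similarity when exactly one of them is zero.\<close>

definition real_affine :: "complex \<Rightarrow> complex \<Rightarrow> complex \<Rightarrow> point \<Rightarrow> point" where
  "real_affine z0 \<alpha> \<beta> p = pt (z0 + \<alpha> * cx p + \<beta> * cnj (cx p))"

lemma linear_real_affine: "linear (real_affine 0 \<alpha> \<beta>)"
proof -
  have "linear (\<lambda>z. \<alpha> * z + \<beta> * cnj z)"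
    by (rule linearI) (simp_all add: scaleR_conv_of_real algebra_simps)
  then have "linear (pt \<circ> ((\<lambda>z. \<alpha> * z + \<beta> * cnj z) \<circ> cx))"
    by (intro linear_compose linear_pt linear_cx)
  then show ?thesis
    by (simp add: real_affine_def[abs_def] comp_def)
qed

lemma real_affine_eq: "real_affine z0 \<alpha> \<beta> = (\<lambda>p. real_affine 0 \<alpha> \<beta> p + pt z0)"
  by (rule ext) (simp add: real_affine_def pt_linear(1)[symmetric] algebra_simps)

lemma affine_map_real_affine: "affine_map (real_affine z0 \<alpha> \<beta>)"
  unfolding affine_map_def using linear_real_affine real_affine_eq by blast

lemma bij_real_affine:
  assumes "cmod \<alpha> \<noteq> cmod \<beta>"
  shows "bij (real_affine z0 \<alpha> \<beta>)"
proof -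
  have inj: "inj (real_affine 0 \<alpha> \<beta>)"
  proof (subst linear_injective_0[OF linear_real_affine], intro allI impI)
    fix p assume "real_affine 0 \<alpha> \<beta> p = 0"
    then have "\<alpha> * cx p + \<beta> * cnj (cx p) = 0"
      by (metis add_0 norm_eq_zero norm_pt real_affine_def)
    then have "cmod \<alpha> * norm p = cmod \<beta> * norm p"
      by (metis add_eq_0_iff complex_mod_cnj norm_cx norm_minus_cancel norm_mult)
    then show "p = 0"
      using assms by simp
  qed
  then have "bij (real_affine 0 \<alpha> \<beta>)"
    using linear_injective_imp_surjective[OF linear_real_affine] by (simp add: bij_def)
  moreover have "bij (\<lambda>p :: point. p + pt z0)"
    by (rule bij_plus_right)
  ultimately have "bij ((\<lambda>p. p + pt z0) \<circ> real_affine 0 \<alpha> \<beta>)"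
    by (rule bij_comp)
  then show ?thesis
    by (simp add: real_affine_eq[of z0] comp_def)
qed

text \<open>If the moduli agree, choose \<open>\<eta>\<close> with \<open>\<eta>\<^sup>2 = \<beta> / \<alpha>\<close>; then
\<open>\<alpha> z + \<beta> cnj z\<close> is a real multiple of \<open>\<alpha> \<eta>\<close>.\<close>

lemma collinear_real_affine:
  assumes "cmod \<alpha> = cmod \<beta>"
  shows "collinear (real_affine z0 \<alpha> \<beta> ` S)"
proof (cases "\<alpha> = 0")
  case True
  then have "real_affine z0 \<alpha> \<beta> p = pt z0" for p
    using assms by (simp add: real_affine_def)
  then show ?thesis
    by (simp add: image_constant_conv)
next
  case False
  define \<eta> where "\<eta> = csqrt (\<beta> / \<alpha>)"
  have "\<eta>\<^sup>2 = \<beta> / \<alpha>"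
    by (simp add: \<eta>_def)
  then have "(cmod \<eta>)\<^sup>2 = 1"
    using assms False by (auto simp: norm_divide simp flip: norm_power)
  then have unit: "\<eta> * cnj \<eta> = 1"
    using complex_norm_square[of \<eta>] by simp
  have conj_coeff: "\<beta> = \<alpha> * \<eta>\<^sup>2"
    using \<open>\<eta>\<^sup>2 = \<beta> / \<alpha>\<close> False by simp
  have "real_affine z0 \<alpha> \<beta> p = pt z0 + (2 * Re (cnj \<eta> * cx p)) *\<^sub>R pt (\<alpha> * \<eta>)" for p
  proof -
    have "\<alpha> * cx p + \<beta> * cnj (cx p) =
        \<alpha> * (\<eta> * cnj \<eta>) * cx p + \<alpha> * \<eta>\<^sup>2 * cnj (cx p)"
      unfolding conj_coeff unit by simp
    also have "\<dots> = \<alpha> * \<eta> * (cnj \<eta> * cx p + cnj (cnj \<eta> * cx p))"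
      by (simp add: algebra_simps power2_eq_square)
    also have "\<dots> = (2 * Re (cnj \<eta> * cx p)) *\<^sub>R (\<alpha> * \<eta>)"
      unfolding complex_add_cnj scaleR_conv_of_real by (simp only: ac_simps)
    finally show ?thesis
      by (simp only: real_affine_def add.assoc pt_linear)
  qed
  then show ?thesis
    unfolding collinear_alt by blast
qed

lemma collinear_real_affine_iff:
  assumes "cmod \<alpha> \<noteq> cmod \<beta>"
  shows "collinear (real_affine z0 \<alpha> \<beta> ` S) \<longleftrightarrow> collinear S"
proof -
  have inj: "inj (real_affine 0 \<alpha> \<beta>)"
    using bij_real_affine[OF assms] by (rule bij_is_inj)
  have "real_affine z0 \<alpha> \<beta> ` S = (+) (pt z0) ` real_affine 0 \<alpha> \<beta> ` S"
    by (simp add: real_affine_eq[of z0] image_image add.commute)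
  then have "aff_dim (real_affine z0 \<alpha> \<beta> ` S) = aff_dim S"
    using aff_dim_translation_eq aff_dim_injective_linear_image[OF linear_real_affine inj] by metis
  then show ?thesis
    by (simp add: collinear_aff_dim)
qed

lemma similarity_map_real_affine:
  assumes "\<alpha> = 0 \<and> \<beta> \<noteq> 0 \<or> \<alpha> \<noteq> 0 \<and> \<beta> = 0"
  shows "similarity_map (real_affine z0 \<alpha> \<beta>)"
proof -
  define c where "c = cmod \<alpha> + cmod \<beta>"
  define f where "f = real_affine 0 (\<alpha> / of_real c) (\<beta> / of_real c)"
  have c: "c > 0"
    using assms by (auto simp: c_def)
  have "norm (f p) = norm p" for p
    using assms by (auto simp: f_def real_affine_def norm_mult norm_divide c_def)
  then have "orthogonal_transformation f"
    by (simp add: orthogonal_transformation f_def linear_real_affine)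
  moreover have "c *\<^sub>R f p + pt z0 = real_affine z0 \<alpha> \<beta> p" for p
  proof -
    have "c *\<^sub>R f p = pt (of_real c * (\<alpha> / of_real c * cx p + \<beta> / of_real c * cnj (cx p)))"
      unfolding f_def real_affine_def pt_linear(3)[symmetric]
        scaleR_conv_of_real[where 'a = complex] add_0 by (rule refl)
    also have "of_real c * (\<alpha> / of_real c * cx p + \<beta> / of_real c * cnj (cx p)) =
        \<alpha> * cx p + \<beta> * cnj (cx p)"
      using c by (simp add: field_simps)
    finally show ?thesis
      by (simp add: real_affine_def pt_linear algebra_simps)
  qed
  ultimately show ?thesis
    unfolding similarity_map_def using c
    by (intro exI[of _ c] exI[of _ f] exI[of _ "pt z0"]) auto
qed

section \<open>Semi-invariance\<close>

lemma triangle_curve_real_affine: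
  assumes "triangle_family \<Psi>" "cmod z1 \<noteq> cmod z2"
    and "triangle_curve (quad_center r p q n) \<Psi> (tri z0 z1 z2) t = Some x"
  shows "x = real_affine z0 (lin_coeff r p q n z1 z2) (conj_coeff r p q n z1 z2)
               (pt (model_point (multiplier \<Psi> t)))"
    and "multiplier \<Psi> t \<noteq> 0"
    and "denom r p q n ((cmod z1)\<^sup>2) ((cmod z2)\<^sup>2) \<noteq> 0"
  using assms(3) unfolding triangle_curve_quad_center[OF assms(1,2)]
  by (simp_all add: real_affine_def split: if_splits)

lemma triangle_curve_defined:
  assumes "triangle_family \<Psi>" "cmod z1 \<noteq> cmod z2"
    and "denom r p q n ((cmod z1)\<^sup>2) ((cmod z2)\<^sup>2) \<noteq> 0" "multiplier \<Psi> t \<noteq> 0"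
    and "r \<Longrightarrow> multiplier \<Psi> t / cnj (multiplier \<Psi> t) \<notin> undefined_phases p q n z1 z2"
  shows "triangle_curve (quad_center r p q n) \<Psi> (tri z0 z1 z2) t =
     Some (real_affine z0 (lin_coeff r p q n z1 z2) (conj_coeff r p q n z1 z2)
               (pt (model_point (multiplier \<Psi> t))))"
  using assms(3-5) unfolding triangle_curve_quad_center[OF assms(1,2)]
  by (simp add: real_affine_def)

lemma non_collinear_curve:
  assumes "triangle_family \<Psi>" "tri z0 z1 z2 \<in> base_triangles"
    and "\<not> collinear (curve_trace (quad_center r p q n) \<Psi> (tri z0 z1 z2))"
  shows "denom r p q n ((cmod z1)\<^sup>2) ((cmod z2)\<^sup>2) \<noteq> 0"
    and "cmod (lin_coeff r p q n z1 z2) \<noteq> cmod (conj_coeff r p q n z1 z2)"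
proof -
  have nd: "cmod z1 \<noteq> cmod z2"
    using assms(2) by (simp add: base_triangles_tri_iff)
  note curve = triangle_curve_real_affine[OF assms(1) nd, of r p q n z0]
  obtain t x where "triangle_curve (quad_center r p q n) \<Psi> (tri z0 z1 z2) t = Some x"
    using assms(3) by (force simp: curve_trace_def)
  then show "denom r p q n ((cmod z1)\<^sup>2) ((cmod z2)\<^sup>2) \<noteq> 0"
    by (rule curve)
  have "curve_trace (quad_center r p q n) \<Psi> (tri z0 z1 z2) \<subseteq>
      real_affine z0 (lin_coeff r p q n z1 z2) (conj_coeff r p q n z1 z2) ` UNIV"
    using curve(1) by (auto simp: curve_trace_def)
  then show "cmod (lin_coeff r p q n z1 z2) \<noteq> cmod (conj_coeff r p q n z1 z2)"
    using assms(3) collinear_real_affine collinear_subset by metis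
qed

theorem semi_invariant_quad_center:
  assumes "triangle_family \<Psi>"
  shows "semi_invariant (quad_center r p q n) \<Psi>"
  unfolding semi_invariant_def
proof (intro exI[of _ "\<lambda>t. pt (model_point (multiplier \<Psi> t))"] ballI)
  fix \<Delta> assume base: "\<Delta> \<in> base_triangles"
  obtain z0 z1 z2 where \<Delta>: "\<Delta> = tri z0 z1 z2"
    by (rule tri_surj)
  let ?F = "real_affine z0 (lin_coeff r p q n z1 z2) (conj_coeff r p q n z1 z2)"
  have nd: "cmod z1 \<noteq> cmod z2"
    using base by (simp add: \<Delta> base_triangles_tri_iff)
  have "bij ?F" if "curve_generating (quad_center r p q n) \<Delta>"
    using that base non_collinear_curve(2) bij_real_affine
    unfolding curve_generating_def decomposable_def \<Delta> by blast
  then show "\<exists>F. affine_map F \<and> (curve_generating (quad_center r p q n) \<Delta> \<longrightarrow> bij F) \<and>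
      (\<forall>t x. triangle_curve (quad_center r p q n) \<Psi> \<Delta> t = Some x \<longrightarrow>
         x = F (pt (model_point (multiplier \<Psi> t))))"
    using triangle_curve_real_affine(1)[OF assms nd] affine_map_real_affine
    unfolding \<Delta> by blast
qed

text \<open>Only the phases in a finite set are lost, so a family that meets each phase at most once loses finitely many
points.\<close>

lemma trace_cofinite:
  assumes fam: "triangle_family \<Psi>" and base: "tri z0 z1 z2 \<in> base_triangles"
    and den: "denom r p q n ((cmod z1)\<^sup>2) ((cmod z2)\<^sup>2) \<noteq> 0"
    and inj: "inj_on (\<lambda>t. multiplier \<Psi> t / cnj (multiplier \<Psi> t)) {t. multiplier \<Psi> t \<noteq> 0}"
  defines "F \<equiv> real_affine z0 (lin_coeff r p q n z1 z2) (conj_coeff r p q n z1 z2)"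
  shows "traces (curve_trace (quad_center r p q n) \<Psi> (tri z0 z1 z2))
           ((\<lambda>t. F (pt (model_point (multiplier \<Psi> t)))) ` {t. multiplier \<Psi> t \<noteq> 0})"
proof -
  define g where "g = (\<lambda>t. F (pt (model_point (multiplier \<Psi> t))))"
  define E where "E = (\<lambda>t. multiplier \<Psi> t / cnj (multiplier \<Psi> t))"
  define K where "K = {t. multiplier \<Psi> t \<noteq> 0}"
  define B where "B = {t \<in> K. r \<and> E t \<in> undefined_phases p q n z1 z2}"
  define T where "T = curve_trace (quad_center r p q n) \<Psi> (tri z0 z1 z2)"
  have nd: "cmod z1 \<noteq> cmod z2" "z1 \<noteq> 0" "z2 \<noteq> 0"
    using base by (auto simp: base_triangles_tri_iff)
  have "finite B"
  proof (cases r)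
    case True
    then have "finite (undefined_phases p q n z1 z2)"
      using finite_undefined_phases nd den by simp
    then have "finite (E -` undefined_phases p q n z1 z2 \<inter> K)"
      using inj by (intro finite_vimage_IntI) (simp_all add: E_def K_def)
    then show ?thesis
      by (rule finite_subset[rotated]) (auto simp: B_def)
  qed (simp add: B_def)
  moreover have "g ` K - T \<subseteq> g ` B"
  proof
    fix x assume x: "x \<in> g ` K - T"
    then obtain t where t: "t \<in> K" "x = g t"
      by blast
    have "t \<in> B"
    proof (rule ccontr)
      assume "t \<notin> B"
      then have "triangle_curve (quad_center r p q n) \<Psi> (tri z0 z1 z2) t = Some x"
        using t triangle_curve_defined[OF fam nd(1) den, of t z0]
        by (auto simp: K_def B_def E_def g_def F_def)
      then show False
        using x by (auto simp: T_def curve_trace_def)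
    qed
    then show "x \<in> g ` B"
      using t by blast
  qed
  moreover have "T \<subseteq> g ` K"
    using triangle_curve_real_affine[OF fam nd(1), of r p q n z0]
    by (force simp: g_def K_def T_def F_def curve_trace_def)
  ultimately show ?thesis
    unfolding traces_def T_def[symmetric] K_def[symmetric] g_def[symmetric]
    using finite_subset[of "g ` K - T" "g ` B"] by blast
qed


section \<open>The aliquot and the nedian family\<close>

lemma multiplier_aliquot:
  "multiplier aliquot t = Complex (- 1 / 2) (sqrt 3 / 2 * (1 - 2 * t))"
  by (simp add: multiplier_def aliquot_def rot3_def complex_eq_iff algebra_simps)

lemma decomposable_aliquot: "decomposable aliquot"
  by (auto simp: decomposable_def triangle_family_def aliquot_def)

lemma nedian_sum: "(1 - t) * t + t\<^sup>2 + (1 - t)\<^sup>2 = (3 + (2 * t - 1)\<^sup>2) / (4 :: real)"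
  by (simp add: power2_eq_square field_simps)

text \<open>In the variable \<open>u = 2 t - 1\<close> the multiplier lies on the circle of center -1 and radius 1, and
it vanishes at \<open>u = 0\<close>.\<close>

lemma multiplier_nedian:
  fixes t :: real
  defines "u \<equiv> 2 * t - 1"
  shows "multiplier nedian t = of_real (2 * u / (3 + u\<^sup>2)) * Complex (- u) (sqrt 3)"
proof -
  have u: "t = (1 + u) / 2"
    by (simp add: u_def)
  have "complex_of_real ((1 - t) * t) + \<omega> * of_real (t\<^sup>2) + cnj \<omega> * of_real ((1 - t)\<^sup>2) =
      of_real (u / 2) * Complex (- u) (sqrt 3)"
    unfolding u by (simp add: rot3_def complex_eq_iff power2_eq_square field_simps)
  moreover have "complex_of_real ((1 - t) * t) + of_real (t\<^sup>2) + of_real ((1 - t)\<^sup>2) =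
      of_real ((3 + u\<^sup>2) / 4)"
    using nedian_sum[of t] unfolding u_def by (metis of_real_add)
  ultimately have "multiplier nedian t =
      of_real (u / 2) * Complex (- u) (sqrt 3) / of_real ((3 + u\<^sup>2) / 4)"
    unfolding multiplier_def nedian_def vector_3 by (simp only: of_real_add)
  also have "\<dots> = of_real (2 * u / (3 + u\<^sup>2)) * Complex (- u) (sqrt 3)"
    by simp
  finally show ?thesis .
qed

lemma multiplier_nedian_eq_0_iff: "multiplier nedian t = 0 \<longleftrightarrow> t = 1 / 2"
proof -
  have "3 + (2 * t - 1)\<^sup>2 \<noteq> 0"
    by (smt (verit) zero_le_power2)
  moreover have "Complex x (sqrt 3) \<noteq> 0" for x
    by (simp add: complex_eq_iff)
  ultimately show ?thesis
    unfolding multiplier_nedian mult_eq_0_iff of_real_eq_0_iff by (auto simp: field_simps)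
qed

lemma decomposable_nedian: "decomposable nedian"
proof -
  have "(1 - t) * t + t\<^sup>2 + (1 - t)\<^sup>2 \<noteq> 0" for t :: real
    unfolding nedian_sum by (smt (verit) divide_eq_0_iff zero_le_power2)
  moreover have "t = 1 / 2" if "2 * ((1 - t) * t) - t\<^sup>2 - (1 - t)\<^sup>2 = 0" for t :: real
  proof -
    have "(2 * t - 1)\<^sup>2 = 0"
      using that by (simp add: power2_eq_square algebra_simps)
    then show ?thesis
      by simp
  qed
  moreover have "(1 - 0) * 0 \<noteq> (1 - 0 :: real)\<^sup>2"
    by simp
  ultimately show ?thesis
    unfolding decomposable_def triangle_family_def nedian_def vector_3
    by (smt (verit, ccfv_threshold) field_sum_of_halves mult_eq_0_iff power_zero_numeral
        power2_eq_square)
qed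

lemma phase_injective:
  assumes "Im (\<mu> * cnj \<nu>) \<noteq> 0" "\<mu> \<noteq> 0" "\<nu> \<noteq> 0"
  shows "\<mu> / cnj \<mu> \<noteq> \<nu> / cnj \<nu>"
proof
  assume "\<mu> / cnj \<mu> = \<nu> / cnj \<nu>"
  then have "\<mu> * cnj \<nu> = cnj (\<mu> * cnj \<nu>)"
    using assms(2,3) by (simp add: field_simps)
  then have "Im (\<mu> * cnj \<nu>) = - Im (\<mu> * cnj \<nu>)"
    by (metis cnj.sel(2))
  then show False
    using assms(1) by simp
qed

lemma inj_on_phase_aliquot:
  "inj_on (\<lambda>t. multiplier aliquot t / cnj (multiplier aliquot t)) {t. multiplier aliquot t \<noteq> 0}"
proof (rule inj_onI, rule ccontr)
  fix t t' assume *: "t \<in> {t. multiplier aliquot t \<noteq> 0}" "t' \<in> {t. multiplier aliquot t \<noteq> 0}"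
    "multiplier aliquot t / cnj (multiplier aliquot t) =
      multiplier aliquot t' / cnj (multiplier aliquot t')" "t \<noteq> t'"
  have "Im (multiplier aliquot t * cnj (multiplier aliquot t')) = sqrt 3 / 2 * (t - t')"
    by (simp add: multiplier_aliquot field_simps)
  also have "\<dots> \<noteq> 0"
    using \<open>t \<noteq> t'\<close> by simp
  finally show False
    using * phase_injective by blast
qed

lemma inj_on_phase_nedian:
  "inj_on (\<lambda>t. multiplier nedian t / cnj (multiplier nedian t)) {t. multiplier nedian t \<noteq> 0}"
proof (rule inj_onI, rule ccontr)
  fix t t' assume *: "t \<in> {t. multiplier nedian t \<noteq> 0}" "t' \<in> {t. multiplier nedian t \<noteq> 0}"
    "multiplier nedian t / cnj (multiplier nedian t) =
      multiplier nedian t' / cnj (multiplier nedian t')" "t \<noteq> t'"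
  define c where "c = (\<lambda>t::real. 2 * (2 * t - 1) / (3 + (2 * t - 1)\<^sup>2))"
  have mult: "multiplier nedian t = of_real (c t) * Complex (- (2 * t - 1)) (sqrt 3)" for t
    unfolding multiplier_nedian c_def ..
  have "c t \<noteq> 0" "c t' \<noteq> 0"
    using * by (auto simp: mult)
  moreover have "Im (multiplier nedian t * cnj (multiplier nedian t')) =
      c t * c t' * (2 * sqrt 3 * (t - t'))"
    unfolding mult by (simp add: algebra_simps)
  ultimately have "Im (multiplier nedian t * cnj (multiplier nedian t')) \<noteq> 0"
    using \<open>t \<noteq> t'\<close> by simp
  with * phase_injective show False
    by blast
qed

lemma model_point_slope:
  fixes x y :: real
  assumes "x \<noteq> 0 \<or> y \<noteq> 0"
  shows "model_point (Complex x y) =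
    Complex (x * (x\<^sup>2 - 3 * y\<^sup>2) / (x\<^sup>2 + y\<^sup>2)) (y * (3 * x\<^sup>2 - y\<^sup>2) / (x\<^sup>2 + y\<^sup>2))"
proof -
  have "x\<^sup>2 + y\<^sup>2 \<noteq> 0"
    using assms by (simp add: sum_power2_eq_zero_iff)
  then show ?thesis
    by (simp add: model_point_def complex_eq_iff Re_divide Im_divide power2_eq_square)
      (simp add: algebra_simps)
qed

lemma model_point_aliquot:
  assumes "s = sqrt 3 * (2 * t - 1)"
  shows "model_point (multiplier aliquot t) - 1 =
     Complex (- (3 - s\<^sup>2) / (2 * (1 + s\<^sup>2))) (- s * (3 - s\<^sup>2) / (2 * (1 + s\<^sup>2)))"
proof -
  have m: "multiplier aliquot t = Complex (- 1 / 2) (- s / 2)"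
    by (simp add: multiplier_aliquot assms algebra_simps)
  have "1 + s\<^sup>2 > 0"
    by (simp add: add_pos_nonneg)
  then have "1 / 4 + s\<^sup>2 / 4 \<noteq> 0" "1 + s\<^sup>2 \<noteq> 0" "1 + s * s \<noteq> 0"
    by (simp_all add: power2_eq_square)
  then show ?thesis
    unfolding m by (subst model_point_slope)
      (simp_all add: complex_eq_iff power2_eq_square divide_simps, simp_all add: algebra_simps)
qed

text \<open>The parameter \<open>s\<close> is the slope of the line from the node to the point. The node itself is met at the slopes
\<open>sqrt 3\<close> and \<open>- sqrt 3\<close>.\<close>

lemma maclaurin_aliquot:
  "maclaurin_trisectrix (- 1) = (\<lambda>t. pt (model_point (multiplier aliquot t) - 1)) ` UNIV"
proof (intro equalityI subsetI)
  {
    fix p assume "p \<in> maclaurin_trisectrix (- 1)"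
    then have p: "2 * p $ 1 * ((p $ 1)\<^sup>2 + (p $ 2)\<^sup>2) = - (3 * (p $ 1)\<^sup>2 - (p $ 2)\<^sup>2)"
      by (simp add: maclaurin_trisectrix_def)
    define s where "s = (if p $ 1 = 0 then sqrt 3 else p $ 2 / p $ 1)"
    define t where "t = (s / sqrt 3 + 1) / 2"
    have "s = sqrt 3 * (2 * t - 1)"
      by (simp add: t_def field_simps)
    note m = model_point_aliquot[OF this]
    have pos: "1 + s\<^sup>2 > 0"
      by (simp add: add_pos_nonneg)
    have "p $ 1 = - (3 - s\<^sup>2) / (2 * (1 + s\<^sup>2)) \<and> p $ 2 = - s * (3 - s\<^sup>2) / (2 * (1 + s\<^sup>2))"
    proof (cases "p $ 1 = 0")
      case True
      with p show ?thesis
        by (simp add: s_def)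
    next
      case False
      have y: "p $ 2 = s * p $ 1"
        using False by (simp add: s_def)
      have "(p $ 1)\<^sup>2 * (2 * (1 + s\<^sup>2) * p $ 1) = (p $ 1)\<^sup>2 * - (3 - s\<^sup>2)"
        using p unfolding y by (simp add: power2_eq_square algebra_simps)
      then have "2 * (1 + s\<^sup>2) * p $ 1 = - (3 - s\<^sup>2)"
        using False by simp
      then have x: "p $ 1 = - (3 - s\<^sup>2) / (2 * (1 + s\<^sup>2))"
        using pos by (simp add: field_simps)
      then have "s * p $ 1 = s * (- (3 - s\<^sup>2) / (2 * (1 + s\<^sup>2)))"
        by (simp only:)
      then show ?thesis
        using x y by (simp only: mult_minus_left mult_minus_right times_divide_eq_right minus_divide_left)
    qed
    then have "p = pt (model_point (multiplier aliquot t) - 1)"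
      unfolding m by (simp add: vec_eq_iff forall_2)
    then show "p \<in> (\<lambda>t. pt (model_point (multiplier aliquot t) - 1)) ` UNIV"
      by blast
  next
    fix p assume "p \<in> (\<lambda>t. pt (model_point (multiplier aliquot t) - 1)) ` UNIV"
    then obtain t where p: "p = pt (model_point (multiplier aliquot t) - 1)"
      by blast
    define s where "s = sqrt 3 * (2 * t - 1)"
    define x where "x = - (3 - s\<^sup>2) / (2 * (1 + s\<^sup>2))"
    have pos: "1 + s\<^sup>2 > 0"
      by (simp add: add_pos_nonneg)
    have "p $ 1 = x" "p $ 2 = s * x"
      unfolding p model_point_aliquot[OF s_def] x_def pt_nth complex.sel
      by (simp_all only: mult_minus_left mult_minus_right times_divide_eq_right minus_divide_left)
    moreover have "2 * (1 + s\<^sup>2) * x = - (3 - s\<^sup>2)"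
      using pos by (simp add: x_def)
    then have "x\<^sup>2 * (2 * (1 + s\<^sup>2) * x) = x\<^sup>2 * - (3 - s\<^sup>2)"
      by simp
    ultimately show "p \<in> maclaurin_trisectrix (- 1)"
      by (simp add: maclaurin_trisectrix_def power2_eq_square algebra_simps)
  }
qed

text \<open>In polar form the Limacon is \<open>k (1 + 2 cos \<phi>)\<close>, that is \<open>k (1 + E + E\<^sup>2)\<close> with \<open>E\<close> the
exponential of \<open>i \<phi>\<close>. The node is met at \<open>E = \<omega>\<close> and its conjugate.\<close>

lemma limacon_unit_circle:
  "limacon_trisectrix (- 1) = (\<lambda>E. pt (- (1 + E + E\<^sup>2))) ` {E. cmod E = 1}"
proof (intro equalityI subsetI)
  have square: "- (1 + E + E\<^sup>2) = of_real (- (1 + 2 * Re E)) * E" if "cmod E = 1" for E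
  proof -
    have "E * cnj E = 1"
      using that complex_norm_square[of E] by simp
    then have "1 + E + E\<^sup>2 = (1 + (E + cnj E)) * E"
      by (simp add: algebra_simps power2_eq_square)
    then show ?thesis
      unfolding complex_add_cnj by (simp add: algebra_simps)
  qed
  {
    fix p assume "p \<in> limacon_trisectrix (- 1)"
    define z where "z = cx p"
    have p: "p = pt z"
      by (simp add: z_def)
    have "(cmod z)\<^sup>2 = ((cmod z)\<^sup>2 + 2 * Re z)\<^sup>2"
      using \<open>p \<in> limacon_trisectrix (- 1)\<close>
      unfolding limacon_trisectrix_def p cmod_power2 by simp
    then have "sqrt ((cmod z)\<^sup>2) = sqrt (((cmod z)\<^sup>2 + 2 * Re z)\<^sup>2)"
      by (rule arg_cong)
    then have z: "cmod z = \<bar>(cmod z)\<^sup>2 + 2 * Re z\<bar>"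
      by (simp only: real_sqrt_abs abs_norm_cancel)
    show "p \<in> (\<lambda>E. pt (- (1 + E + E\<^sup>2))) ` {E. cmod E = 1}"
    proof (cases "z = 0")
      case True
      have "cmod \<omega> = 1" "1 + \<omega> + \<omega>\<^sup>2 = 0"
        by (simp_all add: rot3_def cmod_def complex_eq_iff power2_eq_square)
      then show ?thesis
        using p True by (intro image_eqI[of _ _ \<omega>]) simp_all
    next
      case False
      define \<rho> where "\<rho> = - ((cmod z)\<^sup>2 + 2 * Re z)"
      define E where "E = z / of_real \<rho>"
      have \<rho>: "\<bar>\<rho>\<bar> = cmod z"
        using z by (simp only: \<rho>_def abs_minus_cancel)
      then have "\<rho> \<noteq> 0"
        using False by auto
      have E: "cmod E = 1"
        using \<rho> False by (simp add: E_def norm_divide)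
      have zE: "z = of_real \<rho> * E"
        using \<open>\<rho> \<noteq> 0\<close> by (simp add: E_def)
      have "Re z = \<rho> * Re E"
        by (simp add: zE)
      moreover have "(cmod z)\<^sup>2 = \<rho>\<^sup>2"
        using \<rho> by (metis power2_abs)
      ultimately have "\<rho> = - (\<rho>\<^sup>2 + 2 * (\<rho> * Re E))"
        using \<rho>_def by metis
      then have "\<rho> * (\<rho> + 1 + 2 * Re E) = 0"
        by (simp add: power2_eq_square algebra_simps)
      then have "\<rho> = - (1 + 2 * Re E)"
        using \<open>\<rho> \<noteq> 0\<close> by simp
      then have "z = - (1 + E + E\<^sup>2)"
        using zE square[OF E] by simp
      then show ?thesis
        using E p by blast
    qed
  next
    fix p assume "p \<in> (\<lambda>E. pt (- (1 + E + E\<^sup>2))) ` {E. cmod E = 1}"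
    then obtain E where E: "cmod E = 1" and p: "p = pt (- (1 + E + E\<^sup>2))"
      by blast
    define k where "k = 1 + 2 * Re E"
    have z: "- (1 + E + E\<^sup>2) = of_real (- k) * E"
      using square[OF E] by (simp only: k_def)
    have "(p $ 1)\<^sup>2 + (p $ 2)\<^sup>2 = (cmod (of_real (- k) * E))\<^sup>2"
      unfolding p z cmod_power2 by simp
    also have "\<dots> = k\<^sup>2"
      using E by (simp add: norm_mult)
    finally have r: "(p $ 1)\<^sup>2 + (p $ 2)\<^sup>2 = k\<^sup>2" .
    have x: "p $ 1 = - k * Re E"
      unfolding p z by simp
    have "k\<^sup>2 - 2 * - 1 * (- k * Re E) = k * (k - 2 * Re E)"
      by (simp add: power2_eq_square algebra_simps)
    also have "\<dots> = k"
      by (simp add: k_def)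
    finally have "k\<^sup>2 - 2 * - 1 * p $ 1 = k"
      by (simp only: x)
    then show "p \<in> limacon_trisectrix (- 1)"
      unfolding limacon_trisectrix_def mem_Collect_eq r by simp
  }
qed

lemma nedian_phase:
  fixes u :: real
  defines "E \<equiv> Complex (- u) (sqrt 3) / cnj (Complex (- u) (sqrt 3))"
  shows "of_real (2 * u / (3 + u\<^sup>2)) * Complex (- u) (sqrt 3) = - (1 + E)"
    and "E = Complex ((u\<^sup>2 - 3) / (u\<^sup>2 + 3)) (- 2 * sqrt 3 * u / (u\<^sup>2 + 3))"
proof -
  have pos: "u\<^sup>2 + 3 > 0"
    by (simp add: add_nonneg_pos)
  then have nz: "u * u + 3 \<noteq> 0" "3 + u * u \<noteq> 0"
    by (simp_all add: power2_eq_square add.commute)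
  then show E: "E = Complex ((u\<^sup>2 - 3) / (u\<^sup>2 + 3)) (- 2 * sqrt 3 * u / (u\<^sup>2 + 3))"
    by (simp add: E_def complex_eq_iff Re_divide Im_divide power2_eq_square)
  show "of_real (2 * u / (3 + u\<^sup>2)) * Complex (- u) (sqrt 3) = - (1 + E)"
    using nz unfolding E by (simp add: complex_eq_iff power2_eq_square) (simp add: field_simps)
qed

lemma model_point_nedian:
  assumes "multiplier nedian t \<noteq> 0"
  defines "E \<equiv> multiplier nedian t / cnj (multiplier nedian t)"
  shows "model_point (multiplier nedian t) - 1 = - (1 + E + E\<^sup>2)" and "cmod E = 1"
proof -
  define u where "u = 2 * t - 1"
  define c where "c = 2 * u / (3 + u\<^sup>2)"
  have m: "multiplier nedian t = of_real c * Complex (- u) (sqrt 3)"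
    by (simp only: multiplier_nedian u_def c_def)
  then have "c \<noteq> 0"
    using assms(1) by auto
  then have E: "E = Complex (- u) (sqrt 3) / cnj (Complex (- u) (sqrt 3))"
    unfolding E_def m by simp
  have "multiplier nedian t = - (1 + E)"
    using nedian_phase(1)[of u] m unfolding E c_def by simp
  moreover have "model_point (multiplier nedian t) = multiplier nedian t * E"
    by (simp add: model_point_def E_def power2_eq_square)
  ultimately have m: "model_point (multiplier nedian t) = - (1 + E) * E"
    by (simp only:)
  show "model_point (multiplier nedian t) - 1 = - (1 + E + E\<^sup>2)"
    unfolding m by (simp add: algebra_simps power2_eq_square)
  show "cmod E = 1"
    using assms(1) by (simp add: E_def norm_divide)
qed

text \<open>The missing points have phase -1, which the family approaches at its degenerate parameter, and phase 1, which
it approaches at infinity.\<close>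

lemma limacon_nedian:
  "traces ((\<lambda>t. pt (model_point (multiplier nedian t) - 1)) ` {t. multiplier nedian t \<noteq> 0})
     (limacon_trisectrix (- 1))"
proof -
  define L where "L = (\<lambda>E. pt (- (1 + E + E\<^sup>2)))"
  define S where "S = (\<lambda>t. pt (model_point (multiplier nedian t) - 1)) ` {t. multiplier nedian t \<noteq> 0}"
  have "S \<subseteq> limacon_trisectrix (- 1)"
    unfolding S_def limacon_unit_circle using model_point_nedian by force
  moreover have "limacon_trisectrix (- 1) - S \<subseteq> L ` {1, - 1}"
  proof
    fix p assume p: "p \<in> limacon_trisectrix (- 1) - S"
    then obtain E where E: "cmod E = 1" "p = L E"
      unfolding limacon_unit_circle L_def by blast
    have "E \<in> {1, - 1}"
    proof (rule ccontr)
      assume ne: "E \<notin> {1, - 1}"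
      have circle: "(Re E)\<^sup>2 + (Im E)\<^sup>2 = 1"
        using E(1) cmod_power2[of E] by simp
      have Im: "Im E \<noteq> 0"
      proof
        assume "Im E = 0"
        then have "(Re E)\<^sup>2 = 1"
          using circle by simp
        then show False
          using ne \<open>Im E = 0\<close> by (auto simp: complex_eq_iff power2_eq_1_iff)
      qed
      \<comment> \<open>the multiplier of phase \<open>E\<close> is \<open>- (1 + E)\<close>, and \<open>- u : sqrt 3\<close> is the ratio of its real and imaginary parts\<close>
      define u where "u = - sqrt 3 * (1 + Re E) / Im E"
      define t where "t = (u + 1) / 2"
      have u: "u = 2 * t - 1"
        by (simp add: t_def field_simps)
      have "1 + Re E \<noteq> 0"
      proof
        assume "1 + Re E = 0"
        then have "Re E = - 1"
          by simp
        then show False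
          using circle Im by simp
      qed
      then have "u \<noteq> 0"
        using Im by (simp add: u_def)
      then have nz: "multiplier nedian t \<noteq> 0"
        by (simp add: multiplier_nedian_eq_0_iff u)
      have "u\<^sup>2 * (Im E)\<^sup>2 = 3 * (1 + Re E)\<^sup>2"
        using Im by (simp add: u_def power_divide power_mult_distrib)
      have uI: "u * Im E = - sqrt 3 * (1 + Re E)"
        using Im by (simp add: u_def)
      have s3: "u\<^sup>2 + 3 \<noteq> 0"
        by (smt (verit) zero_le_power2)
      have "(1 + Re E) * ((1 - Re E) * u\<^sup>2) = (1 + Re E) * (3 * (1 + Re E))"
        using \<open>u\<^sup>2 * (Im E)\<^sup>2 = _\<close> circle by algebra
      then have R: "(1 - Re E) * u\<^sup>2 = 3 * (1 + Re E)"
        using \<open>1 + Re E \<noteq> 0\<close> by simp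
      then have "Re E = (u\<^sup>2 - 3) / (u\<^sup>2 + 3)"
        using s3 by (simp add: field_simps)
      moreover have "Im E = - 2 * sqrt 3 * u / (u\<^sup>2 + 3)"
      proof -
        have "u * (Im E * (u\<^sup>2 + 3)) = - sqrt 3 * ((1 + Re E) * (u\<^sup>2 + 3))"
          using uI by algebra
        also have "(1 + Re E) * (u\<^sup>2 + 3) = 2 * u\<^sup>2"
          using R by algebra
        finally have "u * (Im E * (u\<^sup>2 + 3)) = u * (- 2 * sqrt 3 * u)"
          by (simp add: power2_eq_square)
        then have "Im E * (u\<^sup>2 + 3) = - 2 * sqrt 3 * u"
          using \<open>u \<noteq> 0\<close> by (metis mult_left_cancel)
        then show ?thesis
          using s3 by (simp add: field_simps)
      qed
      ultimately have "E = Complex (- u) (sqrt 3) / cnj (Complex (- u) (sqrt 3))"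
        unfolding nedian_phase(2) by (simp add: complex_eq_iff)
      also have "\<dots> = multiplier nedian t / cnj (multiplier nedian t)"
      proof -
        define c where "c = 2 * u / (3 + u\<^sup>2)"
        have m: "multiplier nedian t = of_real c * Complex (- u) (sqrt 3)"
          by (simp only: multiplier_nedian u c_def)
        then have "c \<noteq> 0"
          using nz by auto
        then show ?thesis
          unfolding m by simp
      qed
      finally have "L E = pt (model_point (multiplier nedian t) - 1)"
        using model_point_nedian(1)[OF nz] by (simp add: L_def)
      then show False
        using p E(2) nz by (auto simp: S_def)
    qed
    then show "p \<in> L ` {1, - 1}"
      using E(2) by blast
  qed
  ultimately show ?thesis
    unfolding traces_def S_def[symmetric] using finite_subset by blast
qed


text \<open>The universal curves of both families have their node at 1, the two trisectrices at the origin.\<close>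

lemma real_affine_shift:
  "real_affine z0 \<alpha> \<beta> (pt z) = real_affine (z0 + \<alpha> + \<beta>) \<alpha> \<beta> (pt (z - 1))"
  by (simp add: real_affine_def algebra_simps)

lemma sheared_trace:
  assumes fam: "triangle_family \<Psi>" and base: "tri z0 z1 z2 \<in> base_triangles"
    and cg: "curve_generating (quad_center r p q n) (tri z0 z1 z2)"
    and inj: "inj_on (\<lambda>t. multiplier \<Psi> t / cnj (multiplier \<Psi> t)) {t. multiplier \<Psi> t \<noteq> 0}"
    and C: "traces ((\<lambda>t. pt (model_point (multiplier \<Psi> t) - 1)) ` {t. multiplier \<Psi> t \<noteq> 0}) C"
  shows "\<exists>T. sheared C T \<and> traces (curve_trace (quad_center r p q n) \<Psi> (tri z0 z1 z2)) T"
proof -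
  define \<alpha> \<beta> where "\<alpha> = lin_coeff r p q n z1 z2" and "\<beta> = conj_coeff r p q n z1 z2"
  define F where "F = real_affine (z0 + \<alpha> + \<beta>) \<alpha> \<beta>"
  define S where "S = (\<lambda>t. pt (model_point (multiplier \<Psi> t) - 1)) ` {t. multiplier \<Psi> t \<noteq> 0}"
  define X where "X = curve_trace (quad_center r p q n) \<Psi> (tri z0 z1 z2)"
  obtain \<Psi>' where \<Psi>': "triangle_family \<Psi>'"
    "\<not> collinear (curve_trace (quad_center r p q n) \<Psi>' (tri z0 z1 z2))"
    using cg unfolding curve_generating_def decomposable_def by blast
  note nc = non_collinear_curve[OF \<Psi>'(1) base \<Psi>'(2)]
  have "bij F"
    unfolding F_def using nc(2) by (intro bij_real_affine) (simp add: \<alpha>_def \<beta>_def)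
  moreover have "affine_map F"
    unfolding F_def by (rule affine_map_real_affine)
  ultimately have "sheared C (F ` C)"
    unfolding sheared_def by blast
  moreover have "traces X (F ` C)"
  proof -
    have X: "traces X (F ` S)"
      using trace_cofinite[OF fam base nc(1) inj]
      unfolding X_def S_def F_def image_image real_affine_shift[of z0] \<alpha>_def \<beta>_def .
    have "F ` C - X \<subseteq> (F ` S - X) \<union> F ` (C - S)"
      by blast
    then show ?thesis
      using X C unfolding traces_def S_def[symmetric]
      by (meson finite_Un finite_imageI finite_subset image_mono subset_trans)
  qed
  ultimately show ?thesis
    unfolding X_def by blast
qed

theorem aliquot_curve_maclaurin:
  assumes "\<Delta> \<in> base_triangles" "curve_generating (quad_center r p q n) \<Delta>"
  shows "\<exists>k T. k \<noteq> 0 \<and> sheared (maclaurin_trisectrix k) T \<and>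
           traces (curve_trace (quad_center r p q n) aliquot \<Delta>) T"
proof -
  obtain z0 z1 z2 where \<Delta>: "\<Delta> = tri z0 z1 z2"
    by (rule tri_surj)
  have "multiplier aliquot t \<noteq> 0" for t
    by (simp add: multiplier_aliquot complex_eq_iff)
  then have "traces ((\<lambda>t. pt (model_point (multiplier aliquot t) - 1)) ` {t. multiplier aliquot t \<noteq> 0})
      (maclaurin_trisectrix (- 1))"
    by (simp add: traces_def maclaurin_aliquot)
  then obtain T where "sheared (maclaurin_trisectrix (- 1)) T"
    "traces (curve_trace (quad_center r p q n) aliquot \<Delta>) T"
    using sheared_trace[OF _ _ _ inj_on_phase_aliquot] decomposable_aliquot assms
    unfolding \<Delta> decomposable_def by blast
  then show ?thesis
    by (intro exI[of _ "- 1"] exI[of _ T]) simp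
qed

theorem nedian_curve_limacon:
  assumes "\<Delta> \<in> base_triangles" "curve_generating (quad_center r p q n) \<Delta>"
  shows "\<exists>k T. k \<noteq> 0 \<and> sheared (limacon_trisectrix k) T \<and>
           traces (curve_trace (quad_center r p q n) nedian \<Delta>) T"
proof -
  obtain z0 z1 z2 where \<Delta>: "\<Delta> = tri z0 z1 z2"
    by (rule tri_surj)
  obtain T where "sheared (limacon_trisectrix (- 1)) T"
    "traces (curve_trace (quad_center r p q n) nedian \<Delta>) T"
    using sheared_trace[OF _ _ _ inj_on_phase_nedian limacon_nedian] decomposable_nedian assms
    unfolding \<Delta> decomposable_def by blast
  then show ?thesis
    by (intro exI[of _ "- 1"] exI[of _ T]) simp
qed

lemma finite_quadratic_roots:
  fixes a b c :: real
  assumes "a \<noteq> 0 \<or> b \<noteq> 0 \<or> c \<noteq> 0"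
  shows "finite {x. a * x\<^sup>2 + b * x + c = 0}"
proof -
  have "finite {x. poly [:c, b, a:] x = 0}"
    using assms by (intro poly_roots_finite) auto
  then show ?thesis
    by (simp add: power2_eq_square algebra_simps)
qed

lemma collinear_imp_line:
  fixes S :: "point set"
  assumes "collinear S"
  obtains a b c where "a \<noteq> 0 \<or> b \<noteq> 0" "\<And>x. x \<in> S \<Longrightarrow> a * x $ 1 + b * x $ 2 = c"
proof -
  obtain u v where uv: "\<And>x. x \<in> S \<Longrightarrow> \<exists>k. x = u + k *\<^sub>R v"
    using assms unfolding collinear_alt by blast
  show ?thesis
  proof (cases "v = 0")
    case True
    then show ?thesis
      using uv that[of 1 0 "u $ 1"] by force
  next
    case False
    then have "v $ 2 \<noteq> 0 \<or> - v $ 1 \<noteq> 0"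
      by (auto simp: vec_eq_iff forall_2)
    moreover have "v $ 2 * x $ 1 + - v $ 1 * x $ 2 = v $ 2 * u $ 1 - v $ 1 * u $ 2" if "x \<in> S" for x
      using uv[OF that] by (auto simp: algebra_simps)
    ultimately show ?thesis
      by (rule that)
  qed
qed

text \<open>A line meets the rational cubic in the zeros of a polynomial of degree at most three in the slope parameter.\<close>

lemma finite_line_maclaurin:
  assumes "a \<noteq> 0 \<or> b \<noteq> 0"
  defines "z \<equiv> \<lambda>t. model_point (multiplier aliquot t) - 1"
  shows "finite {t. a * Re (z t) + b * Im (z t) = c}"
proof -
  have "finite {s. poly [: - (3 * a + 2 * c), - 3 * b, a - 2 * c, b :] s = 0}"
    using assms(1) by (intro poly_roots_finite) auto
  moreover have "poly [: - (3 * a + 2 * c), - 3 * b, a - 2 * c, b :] (sqrt 3 * (2 * t - 1)) = 0"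
    if "a * Re (z t) + b * Im (z t) = c" for t
  proof -
    define s where "s = sqrt 3 * (2 * t - 1)"
    have "1 + s\<^sup>2 > 0"
      by (simp add: add_pos_nonneg)
    moreover have "(a * - (3 - s\<^sup>2) + b * (- s * (3 - s\<^sup>2))) / (2 * (1 + s\<^sup>2)) = c"
      using that unfolding z_def model_point_aliquot[OF s_def] by (simp add: add_divide_distrib)
        (simp add: diff_divide_distrib right_diff_distrib)
    ultimately have "a * - (3 - s\<^sup>2) + b * (- s * (3 - s\<^sup>2)) = c * (2 * (1 + s\<^sup>2))"
      by (simp add: divide_eq_eq)
    then show ?thesis
      unfolding s_def[symmetric] by (simp add: power2_eq_square algebra_simps)
  qed
  ultimately have "finite ((\<lambda>t. sqrt 3 * (2 * t - 1)) ` {t. a * Re (z t) + b * Im (z t) = c})"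
    by (elim finite_subset[rotated]) blast
  then show ?thesis
    by (rule finite_imageD) (auto simp: inj_on_def)
qed

text \<open>The aliquot family is a witness: its curve covers all but finitely many points of an affine image of a
Maclaurin trisectrix, which no line can contain.\<close>

lemma curve_generating_quad_centerI:
  assumes base: "tri z0 z1 z2 \<in> base_triangles"
    and den: "denom r p q n ((cmod z1)\<^sup>2) ((cmod z2)\<^sup>2) \<noteq> 0"
    and ab: "cmod (lin_coeff r p q n z1 z2) \<noteq> cmod (conj_coeff r p q n z1 z2)"
  shows "curve_generating (quad_center r p q n) (tri z0 z1 z2)"
  unfolding curve_generating_def
proof (intro exI conjI)
  show "decomposable aliquot"
    by (rule decomposable_aliquot)
  define \<alpha> \<beta> where "\<alpha> = lin_coeff r p q n z1 z2" and "\<beta> = conj_coeff r p q n z1 z2"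
  define F where "F = real_affine (z0 + \<alpha> + \<beta>) \<alpha> \<beta>"
  define g where "g = (\<lambda>t. pt (model_point (multiplier aliquot t) - 1))"
  define X where "X = curve_trace (quad_center r p q n) aliquot (tri z0 z1 z2)"
  have bij: "bij F"
    unfolding F_def using ab by (intro bij_real_affine) (simp add: \<alpha>_def \<beta>_def)
  have nz: "{t. multiplier aliquot t \<noteq> 0} = UNIV"
    by (simp add: multiplier_aliquot complex_eq_iff)
  have fam: "triangle_family aliquot"
    using decomposable_aliquot by (simp add: decomposable_def)
  have "traces X ((\<lambda>t. F (g t)) ` UNIV)"
    using trace_cofinite[OF fam base den inj_on_phase_aliquot]
    unfolding X_def F_def g_def nz real_affine_shift[of z0] \<alpha>_def \<beta>_def .
  then have fin: "finite ((\<lambda>t. F (g t)) ` UNIV - X)"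
    by (simp add: traces_def)
  show "\<not> collinear X"
  proof
    assume "collinear X"
    define G where "G = {t. F (g t) \<in> X}"
    have "collinear (F ` g ` G)"
      using \<open>collinear X\<close> by (rule collinear_subset) (auto simp: G_def)
    then have "collinear (g ` G)"
      unfolding F_def using ab collinear_real_affine_iff by (simp add: \<alpha>_def \<beta>_def)
    then obtain a b c where line: "a \<noteq> 0 \<or> b \<noteq> 0" "\<And>x. x \<in> g ` G \<Longrightarrow> a * x $ 1 + b * x $ 2 = c"
      by (rule collinear_imp_line) blast
    have "finite G"
      by (rule finite_subset[OF _ finite_line_maclaurin[OF line(1), of c]])
        (use line(2) in \<open>force simp: g_def\<close>)
    moreover have "F ` g ` UNIV \<subseteq> F ` g ` G \<union> ((\<lambda>t. F (g t)) ` UNIV - X)"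
      by (auto simp: G_def)
    ultimately have "finite (F ` g ` UNIV)"
      using fin by (meson finite_Un finite_imageI finite_subset)
    then have fin_g: "finite (range g)"
      using bij finite_imageD[of F "range g"] by (meson bij_is_inj inj_on_subset subset_UNIV)
    \<comment> \<open>a finite set of points lies on finitely many vertical lines\<close>
    have "UNIV \<subseteq> (\<Union>x\<in>range g. {t. 1 * Re (model_point (multiplier aliquot t) - 1)
              + 0 * Im (model_point (multiplier aliquot t) - 1) = x $ 1})"
      by (auto simp: g_def)
    moreover have "finite \<dots>"
      using fin_g by (intro finite_UN_I finite_line_maclaurin) auto
    ultimately show False
      using infinite_UNIV_char_0[where 'a = real] finite_subset by blast
  qed
qed


section \<open>Finitely many exceptional Brocard angles\<close>

text \<open>The shifted level after scaling to \<open>|P - Q| = 1\<close>, as a linear function of \<open>v = (P + Q) / |P - Q|\<close>.\<close>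

definition shape_level :: "real \<Rightarrow> real \<Rightarrow> real \<Rightarrow> real \<Rightarrow> real" where
  "shape_level p q n v = (9 / 2 * n - 9 * p) * v - 3 * sqrt 3 * q"

lemma shifted_level_shape:
  assumes "P \<noteq> Q" and "v = (P + Q) / \<bar>P - Q\<bar>"
  shows "shifted_level p q n P Q = \<bar>P - Q\<bar> * shape_level p q n v"
proof -
  have "P + Q = \<bar>P - Q\<bar> * v"
    using assms by simp
  then show ?thesis
    unfolding shifted_level_def level_def shape_level_def by (simp only:) (simp add: algebra_simps)
qed

lemma denom_shape:
  assumes "P \<noteq> Q" and v: "v = (P + Q) / \<bar>P - Q\<bar>"
  shows "denom False p q n P Q = (P - Q)\<^sup>2 * (3 / 2 * n - v * shape_level p q n v)"
    and "denom True p q n P Q =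
      (P - Q)\<^sup>2 * ((shape_level p q n v)\<^sup>2 - 3 * n * v * shape_level p q n v + 9 / 4 * n\<^sup>2)"
proof -
  define d where "d = \<bar>P - Q\<bar>"
  have s: "P + Q = d * v"
    using assms by (simp add: d_def)
  have d2: "(P - Q) * (P - Q) = d * d"
    by (simp add: d_def)
  note h = shifted_level_shape[OF assms, folded d_def, of p q n]
  have "denom False p q n P Q = 3 / 2 * n * ((P - Q) * (P - Q)) - (P + Q) * shifted_level p q n P Q"
    by (simp add: denom_def)
  then show "denom False p q n P Q = (P - Q)\<^sup>2 * (3 / 2 * n - v * shape_level p q n v)"
    unfolding d2 power2_eq_square h s by (simp add: algebra_simps)
  have "denom True p q n P Q = (shifted_level p q n P Q)\<^sup>2 - 3 * n * (P + Q) * shifted_level p q n P Q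
      + 9 / 4 * n\<^sup>2 * ((P - Q) * (P - Q))"
    by (simp add: denom_def power2_eq_square)
  then show "denom True p q n P Q =
      (P - Q)\<^sup>2 * ((shape_level p q n v)\<^sup>2 - 3 * n * v * shape_level p q n v + 9 / 4 * n\<^sup>2)"
    unfolding power2_eq_square[of "P - Q"] d2 h s by (simp add: power2_eq_square algebra_simps)
qed

lemma cmod_coeffs:
  fixes z1 z2 :: complex
  defines "P \<equiv> (cmod z1)\<^sup>2" and "Q \<equiv> (cmod z2)\<^sup>2"
  shows "(cmod (lin_coeff r p q n z1 z2))\<^sup>2 = P * Q * ((coefU r p q n P Q)\<^sup>2 * P)"
    and "(cmod (conj_coeff r p q n z1 z2))\<^sup>2 = P * Q * ((coefV r p q n P Q)\<^sup>2 * Q)"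
  unfolding P_def Q_def lin_coeff_def conj_coeff_def covU_def covV_def
  by (simp_all add: norm_mult norm_power power_mult_distrib power2_eq_square)

lemma coef_balance:
  fixes h e P Q :: real
  shows "(h + e)\<^sup>2 * P - (h - e)\<^sup>2 * Q = (h\<^sup>2 + e\<^sup>2) * (P - Q) + 2 * h * e * (P + Q)"
  by (simp add: power2_eq_square algebra_simps)

text \<open>The equation \<open>|\<alpha>| = |\<beta>|\<close> reads \<open>(h + e)\<^sup>2 P = (h - e)\<^sup>2 Q\<close> up to the common factor
\<open>P Q\<close>, with \<open>h\<close> the shifted level and \<open>e = 3/2 n (P - Q)\<close>, up to the sign of \<open>e\<close>. It contains the factor \<open>P - Q\<close>, and what remains is
quadratic. For the reciprocal function the remaining factor coincides with the denominator of
the center.\<close>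

lemma not_curve_generating_shape:
  assumes base: "tri z0 z1 z2 \<in> base_triangles"
    and not_cg: "\<not> curve_generating (quad_center r p q n) (tri z0 z1 z2)"
    and n: "r \<Longrightarrow> n \<noteq> 0"
  defines "v \<equiv> ((cmod z1)\<^sup>2 + (cmod z2)\<^sup>2) / \<bar>(cmod z1)\<^sup>2 - (cmod z2)\<^sup>2\<bar>"
  shows "if r then (shape_level p q n v)\<^sup>2 - 3 * n * v * shape_level p q n v + 9 / 4 * n\<^sup>2 = 0
    else 3 / 2 * n - v * shape_level p q n v = 0 \<or>
      (shape_level p q n v)\<^sup>2 + 3 * n * v * shape_level p q n v + 9 / 4 * n\<^sup>2 = 0"
proof -
  define P Q where PQ: "P = (cmod z1)\<^sup>2" "Q = (cmod z2)\<^sup>2"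
  define d where "d = \<bar>P - Q\<bar>"
  have ne: "P \<noteq> Q" and pos: "P \<noteq> 0" "Q \<noteq> 0"
    using base by (auto simp: base_triangles_tri_iff PQ)
  have v: "v = (P + Q) / \<bar>P - Q\<bar>"
    by (simp add: v_def PQ)
  have d0: "d > 0"
    using ne by (simp add: d_def)
  define h e where "h = shifted_level p q n P Q" and "e = 3 / 2 * n * (P - Q)"
  note shape = denom_shape[OF ne v, of p q n] shifted_level_shape[OF ne v, of p q n, folded h_def]
  show ?thesis
  proof (cases "denom r p q n P Q = 0")
    case True
    then show ?thesis
      using shape ne by (auto split: if_splits)
  next
    case False
    then have "cmod (lin_coeff r p q n z1 z2) = cmod (conj_coeff r p q n z1 z2)"
      using curve_generating_quad_centerI[OF base, of r p q n] not_cg by (auto simp: PQ)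
    then have "P * Q * ((coefU r p q n P Q)\<^sup>2 * P) = P * Q * ((coefV r p q n P Q)\<^sup>2 * Q)"
      using cmod_coeffs[of r p q n z1 z2] by (simp only: PQ)
    then have eq: "(coefU r p q n P Q)\<^sup>2 * P - (coefV r p q n P Q)\<^sup>2 * Q = 0"
      using pos by simp
    have "P - Q \<noteq> 0" "P + Q = d * v"
      using ne d0 by (simp_all add: v d_def)
    have e2: "e\<^sup>2 = d\<^sup>2 * (9 / 4 * n\<^sup>2)"
      by (simp add: e_def d_def power_mult_distrib power_divide)
    have h: "h = d * shape_level p q n v"
      using shape(3) by (simp add: d_def)
    have factor: "(h\<^sup>2 + e\<^sup>2) * (P - Q) + 2 * h * e * (P + Q) =
        (P - Q) * (h\<^sup>2 + e\<^sup>2 + 3 * n * h * (P + Q))"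
      by (simp add: e_def field_simps)
    have factor': "(h\<^sup>2 + e\<^sup>2) * (P - Q) - 2 * h * e * (P + Q) =
        (P - Q) * (h\<^sup>2 + e\<^sup>2 - 3 * n * h * (P + Q))"
      by (simp add: e_def field_simps)
    show ?thesis
    proof (cases r)
      case r: False
      have "((h + e)\<^sup>2 * P - (h - e)\<^sup>2 * Q) / (denom r p q n P Q)\<^sup>2 = 0"
      proof -
        have "coefU r p q n P Q = (h + e) / denom r p q n P Q"
          "coefV r p q n P Q = (h - e) / denom r p q n P Q"
          using r by (simp_all only: coefU_def coefV_def h_def e_def if_False)
        moreover have "(x / D)\<^sup>2 * P - (y / D)\<^sup>2 * Q = (x\<^sup>2 * P - y\<^sup>2 * Q) / D\<^sup>2" for x y D
          by (simp add: power_divide diff_divide_distrib)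
        ultimately show ?thesis
          using eq by (simp only:)
      qed
      then have "h\<^sup>2 + e\<^sup>2 + 3 * n * h * (P + Q) = 0"
        using False \<open>P - Q \<noteq> 0\<close> unfolding coef_balance factor by simp
      then have "d\<^sup>2 * ((shape_level p q n v)\<^sup>2 + 3 * n * v * shape_level p q n v + 9 / 4 * n\<^sup>2) = 0"
        unfolding e2 \<open>P + Q = d * v\<close> h by (simp add: power2_eq_square algebra_simps)
      then show ?thesis
        using d0 r by simp
    next
      case r: True
      have "(3 * n)\<^sup>2 * ((h + - e)\<^sup>2 * P - (h - - e)\<^sup>2 * Q) / (denom r p q n P Q)\<^sup>2 = 0"
      proof -
        have "coefU r p q n P Q = 3 * n * (h + - e) / denom r p q n P Q"
          "coefV r p q n P Q = 3 * n * (h - - e) / denom r p q n P Q"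
          using r by (simp_all only: coefU_def coefV_def h_def e_def if_True diff_minus_eq_add
              add_uminus_conv_diff)
        moreover have "(3 * n * x / D)\<^sup>2 * P - (3 * n * y / D)\<^sup>2 * Q =
            (3 * n)\<^sup>2 * (x\<^sup>2 * P - y\<^sup>2 * Q) / D\<^sup>2" for x y D
          by (simp add: power_divide power_mult_distrib diff_divide_distrib right_diff_distrib)
        ultimately show ?thesis
          using eq by (simp only:)
      qed
      then have "h\<^sup>2 + e\<^sup>2 - 3 * n * h * (P + Q) = 0"
        using False \<open>P - Q \<noteq> 0\<close> n[OF r] factor' unfolding coef_balance by simp
      then have "d\<^sup>2 * ((shape_level p q n v)\<^sup>2 - 3 * n * v * shape_level p q n v + 9 / 4 * n\<^sup>2) = 0"
        unfolding e2 \<open>P + Q = d * v\<close> h by (simp add: power2_eq_square algebra_simps)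
      then show ?thesis
        using d0 r by simp
    qed
  qed
qed

text \<open>The first three polynomials vanish identically only if the parameters vanish; the last one, which governs
the vanishing of one of the two coefficients, does so also for the isodynamic and isogonic centers.\<close>

lemma finite_shape_sets:
  assumes "p \<noteq> 0 \<or> q \<noteq> 0 \<or> n \<noteq> 0"
  shows "finite {v. 3 / 2 * n - v * shape_level p q n v = 0}"
    and "finite {v. (shape_level p q n v)\<^sup>2 + 3 * n * v * shape_level p q n v + 9 / 4 * n\<^sup>2 = 0}"
    and "n \<noteq> 0 \<Longrightarrow>
      finite {v. (shape_level p q n v)\<^sup>2 - 3 * n * v * shape_level p q n v + 9 / 4 * n\<^sup>2 = 0}"
    and "\<not> (n = 2 * p \<and> p\<^sup>2 = 3 * q\<^sup>2) \<Longrightarrow> finite {v. (shape_level p q n v)\<^sup>2 = (3 / 2 * n)\<^sup>2}"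
proof -
  define A where "A = 9 / 2 * n - 9 * p"
  define B where "B = - 3 * sqrt 3 * q"
  have H: "shape_level p q n v = A * v + B" for v
    by (simp add: shape_level_def A_def B_def)
  have ABn: "A \<noteq> 0 \<or> B \<noteq> 0 \<or> n \<noteq> 0"
    using assms by (auto simp: A_def B_def)
  have 1: "3 / 2 * n - v * shape_level p q n v = (- A) * v\<^sup>2 + (- B) * v + 3 / 2 * n" for v
    by (simp add: H power2_eq_square algebra_simps)
  show "finite {v. 3 / 2 * n - v * shape_level p q n v = 0}"
    unfolding 1 using ABn by (intro finite_quadratic_roots) auto
  have 2: "(shape_level p q n v)\<^sup>2 + 3 * n * v * shape_level p q n v + 9 / 4 * n\<^sup>2 =
      (A * (A + 3 * n)) * v\<^sup>2 + (B * (2 * A + 3 * n)) * v + (B\<^sup>2 + 9 / 4 * n\<^sup>2)" for v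
    by (simp add: H power2_eq_square algebra_simps)
  have pos: "B\<^sup>2 + 9 / 4 * n\<^sup>2 = 0 \<longleftrightarrow> B = 0 \<and> n = 0"
    by (simp add: add_nonneg_eq_0_iff)
  show "finite {v. (shape_level p q n v)\<^sup>2 + 3 * n * v * shape_level p q n v + 9 / 4 * n\<^sup>2 = 0}"
    unfolding 2 using ABn pos by (intro finite_quadratic_roots) auto
  have 3: "(shape_level p q n v)\<^sup>2 - 3 * n * v * shape_level p q n v + 9 / 4 * n\<^sup>2 =
      (A * (A - 3 * n)) * v\<^sup>2 + (B * (2 * A - 3 * n)) * v + (B\<^sup>2 + 9 / 4 * n\<^sup>2)" for v
    by (simp add: H power2_eq_square algebra_simps)
  show "finite {v. (shape_level p q n v)\<^sup>2 - 3 * n * v * shape_level p q n v + 9 / 4 * n\<^sup>2 = 0}"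
    if "n \<noteq> 0"
    unfolding 3 using that pos by (intro finite_quadratic_roots) auto
  have 4: "(shape_level p q n v)\<^sup>2 = (3 / 2 * n)\<^sup>2 \<longleftrightarrow>
      A\<^sup>2 * v\<^sup>2 + (2 * A * B) * v + (B\<^sup>2 - (3 / 2 * n)\<^sup>2) = 0" for v
    by (simp add: H power2_eq_square algebra_simps)
  show "finite {v. (shape_level p q n v)\<^sup>2 = (3 / 2 * n)\<^sup>2}" if "\<not> (n = 2 * p \<and> p\<^sup>2 = 3 * q\<^sup>2)"
  proof -
    have "B\<^sup>2 - (3 / 2 * n)\<^sup>2 = 9 * (3 * q\<^sup>2 - p\<^sup>2)" if "A = 0"
      using that by (simp add: A_def B_def power_mult_distrib)
    then show ?thesis
      unfolding 4 using that by (intro finite_quadratic_roots) (auto simp: A_def)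
  qed
qed

theorem finite_exceptional_brocard:
  assumes "p \<noteq> 0 \<or> q \<noteq> 0 \<or> n \<noteq> 0" "r \<Longrightarrow> n \<noteq> 0"
  shows "finite (brocard_cot ` {\<Delta> \<in> base_triangles. \<not> curve_generating (quad_center r p q n) \<Delta>})"
proof -
  define R where "R = (if r
    then {v. (shape_level p q n v)\<^sup>2 - 3 * n * v * shape_level p q n v + 9 / 4 * n\<^sup>2 = 0}
    else {v. 3 / 2 * n - v * shape_level p q n v = 0} \<union>
      {v. (shape_level p q n v)\<^sup>2 + 3 * n * v * shape_level p q n v + 9 / 4 * n\<^sup>2 = 0})"
  have "finite R"
    unfolding R_def using finite_shape_sets[OF assms(1)] assms(2) by simp
  moreover have "brocard_cot \<Delta> \<in> (\<lambda>v. sqrt 3 * v) ` R"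
    if "\<Delta> \<in> base_triangles" "\<not> curve_generating (quad_center r p q n) \<Delta>" for \<Delta>
  proof -
    obtain z0 z1 z2 where \<Delta>: "\<Delta> = tri z0 z1 z2"
      by (rule tri_surj)
    define v where "v = ((cmod z1)\<^sup>2 + (cmod z2)\<^sup>2) / \<bar>(cmod z1)\<^sup>2 - (cmod z2)\<^sup>2\<bar>"
    have "v \<in> R"
      using not_curve_generating_shape[OF that[unfolded \<Delta>] assms(2), folded v_def]
      by (auto simp: R_def split: if_splits)
    moreover have "brocard_cot \<Delta> = sqrt 3 * v"
      by (simp only: \<Delta> brocard_cot_tri v_def)
    ultimately show ?thesis
      by blast
  qed
  then have "brocard_cot ` {\<Delta> \<in> base_triangles. \<not> curve_generating (quad_center r p q n) \<Delta>}
      \<subseteq> (\<lambda>v. sqrt 3 * v) ` R"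
    by blast
  ultimately show ?thesis
    by (meson finite_imageI finite_subset)
qed


section \<open>The invariant centers\<close>

lemma not_collinear_triple:
  assumes "\<not> collinear (S :: 'a::euclidean_space set)"
  obtains a b c where "a \<in> S" "b \<in> S" "c \<in> S" "\<not> collinear {a, b, c}"
proof -
  obtain a where a: "a \<in> S"
    using assms by (metis collinear_empty ex_in_conv)
  have "\<not> S \<subseteq> {a}"
    using assms collinear_subset collinear_sing by metis
  then obtain b where b: "b \<in> S" "a \<noteq> b"
    by blast
  have "insert a (insert b S) = S"
    using a b by blast
  then have "\<exists>c\<in>S. \<not> collinear {a, b, c}"
    using assms collinear_triples[OF b(2), of S] by simp
  then show ?thesis
    using that a b by blast
qed

lemma infinite_unit_circle: "infinite {E :: complex. cmod E = 1}"
proof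
  assume "finite {E :: complex. cmod E = 1}"
  then have "finite (Re ` {E :: complex. cmod E = 1})"
    by (rule finite_imageI)
  moreover have "{0..1} \<subseteq> Re ` {E :: complex. cmod E = 1}"
  proof
    fix x :: real assume "x \<in> {0..1}"
    then have "x\<^sup>2 \<le> 1"
      by (simp add: power_le_one)
    then have "cmod (Complex x (sqrt (1 - x\<^sup>2))) = 1"
      by (simp add: cmod_def)
    then show "x \<in> Re ` {E :: complex. cmod E = 1}"
      by (intro image_eqI[of _ _ "Complex x (sqrt (1 - x\<^sup>2))"]) simp_all
  qed
  ultimately show False
    using infinite_Icc[of "0 :: real" 1] finite_subset zero_less_one by metis
qed

lemma similarity_dist:
  assumes "similarity_map F"
  obtains c where "c > 0" "\<And>x y. norm (F x - F y) = c * norm (x - y)"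
proof -
  obtain c f v where F: "c > 0" "orthogonal_transformation f" "F = (\<lambda>x. c *\<^sub>R f x + v)"
    using assms unfolding similarity_map_def by blast
  have "norm (F x - F y) = c * norm (x - y)" for x y
  proof -
    have "F x - F y = c *\<^sub>R f (x - y)"
      using orthogonal_transformation_linear[OF F(2)]
      by (simp add: F(3) linear_diff scaleR_diff_right)
    then show ?thesis
      using F(1) orthogonal_transformation_norm[OF F(2)] by simp
  qed
  then show ?thesis
    using that F(1) by blast
qed

lemma cmod_sq_real_linear:
  "(cmod (\<alpha> * d + \<beta> * cnj d))\<^sup>2 =
     ((cmod \<alpha>)\<^sup>2 + (cmod \<beta>)\<^sup>2) * (cmod d)\<^sup>2 + 2 * Re (\<alpha> * cnj \<beta> * d\<^sup>2)"
  unfolding cmod_power2 by (simp add: power2_eq_square) (simp add: algebra_simps)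

lemma undefined_phases_rotate:
  assumes "cmod E = 1" "E' \<in> undefined_phases p q n (z1 * E) z2"
  shows "E' * E \<in> undefined_phases p q n z1 z2"
proof -
  have "Re (\<nu> * (z1 * E) * cnj z2 * E') = Re (\<nu> * z1 * cnj z2 * (E' * E))" for \<nu>
    by (simp only: ac_simps)
  then show ?thesis
    using assms by (simp only: undefined_phases_def mem_Collect_eq norm_mult) (simp only: mult_1_right simp_thms)
qed

text \<open>Fix three parameters at which the curve of one base triangle has non-collinear points, and let \<open>d2, d3\<close> be
the difference vectors of the universal curve. The base triangles with \<open>z1 = sqrt P E\<close>,
\<open>z2 = sqrt Q\<close> have affine maps with constant \<open>|\<alpha>|\<close>, \<open>|\<beta>|\<close>, while
\<open>\<alpha> cnj \<beta> = k E\<^sup>3\<close>. By invariance the ratio \<open>R2 : R3\<close> of the lengths of the images of \<open>d2\<close>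
and \<open>d3\<close> does not depend on \<open>E\<close>. Comparing the parts that vary with \<open>E\<close> gives
\<open>(R3 d2)\<^sup>2 = (R2 d3)\<^sup>2\<close> if \<open>k \<noteq> 0\<close>, so \<open>d2\<close> and \<open>d3\<close> would be parallel.\<close>

lemma invariant_imp_coef_zero:
  assumes fam: "triangle_family \<Psi>"
    and inv: "invariant (quad_center r p q n) \<Psi>"
    and base: "\<Delta> \<in> base_triangles"
    and nc: "\<not> collinear (curve_trace (quad_center r p q n) \<Psi> \<Delta>)"
    and PQ: "P > 0" "Q > 0" "P \<noteq> Q"
    and den: "denom r p q n P Q \<noteq> 0"
  shows "coefU r p q n P Q = 0 \<or> coefV r p q n P Q = 0"
proof (rule ccontr)
  assume nonzero: "\<not> ?thesis"
  define X where "X = quad_center r p q n"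
  define m where "m = (\<lambda>t. model_point (multiplier \<Psi> t))"
  define phase where "phase = (\<lambda>t. multiplier \<Psi> t / cnj (multiplier \<Psi> t))"
  obtain \<gamma> where \<gamma>: "\<And>\<Delta>. \<Delta> \<in> base_triangles \<Longrightarrow> \<exists>F. similarity_map F \<and>
      (\<forall>t x. triangle_curve X \<Psi> \<Delta> t = Some x \<longrightarrow> x = F (\<gamma> t))"
    using inv unfolding invariant_def X_def by blast
  obtain z0 z1 z2 where \<Delta>: "\<Delta> = tri z0 z1 z2"
    by (rule tri_surj)
  have nd: "cmod z1 \<noteq> cmod z2"
    using base by (simp add: \<Delta> base_triangles_tri_iff)
  obtain x1 x2 x3 where "x1 \<in> curve_trace X \<Psi> \<Delta>" "x2 \<in> curve_trace X \<Psi> \<Delta>"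
    "x3 \<in> curve_trace X \<Psi> \<Delta>" and x_nc: "\<not> collinear {x1, x2, x3}"
    using nc unfolding X_def by (rule not_collinear_triple)
  then obtain t1 t2 t3 where t: "triangle_curve X \<Psi> \<Delta> t1 = Some x1"
    "triangle_curve X \<Psi> \<Delta> t2 = Some x2" "triangle_curve X \<Psi> \<Delta> t3 = Some x3"
    unfolding curve_trace_def by blast
  define d2 d3 where "d2 = m t2 - m t1" and "d3 = m t3 - m t1"
  have indep: "Im (d2 * cnj d3) \<noteq> 0"
  proof -
    let ?F = "real_affine z0 (lin_coeff r p q n z1 z2) (conj_coeff r p q n z1 z2)"
    have "{x1, x2, x3} = ?F ` pt ` {m t1, m t2, m t3}"
      using triangle_curve_real_affine(1)[OF fam nd] t unfolding X_def \<Delta> m_def by simp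
    then have "\<not> collinear (pt ` {m t1, m t2, m t3})"
      using x_nc collinear_real_affine_iff non_collinear_curve(2)[OF fam base[unfolded \<Delta>] nc[unfolded \<Delta>]]
      by metis
    then show ?thesis
      unfolding collinear_pt_iff collinear_complex_iff d2_def d3_def .
  qed
  have mult_nz: "multiplier \<Psi> t1 \<noteq> 0" "multiplier \<Psi> t2 \<noteq> 0" "multiplier \<Psi> t3 \<noteq> 0"
    using triangle_curve_real_affine(2)[OF fam nd] t unfolding X_def \<Delta> by blast+
  define R2 R3 where "R2 = norm (\<gamma> t2 - \<gamma> t1)" and "R3 = norm (\<gamma> t3 - \<gamma> t1)"
  have R: "R2 > 0" "R3 > 0"
  proof -
    obtain F where F: "similarity_map F" "\<And>t x. triangle_curve X \<Psi> \<Delta> t = Some x \<Longrightarrow> x = F (\<gamma> t)"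
      using \<gamma>[OF base] by blast
    have "x2 \<noteq> x1" "x3 \<noteq> x1"
      using x_nc by (auto simp: insert_commute)
    then show "R2 > 0" "R3 > 0"
      using F(2)[OF t(1)] F(2)[OF t(2)] F(2)[OF t(3)] by (auto simp: R2_def R3_def)
  qed
  define z1' z2' where "z1' = complex_of_real (sqrt P)" and "z2' = complex_of_real (sqrt Q)"
  have z': "(cmod z1')\<^sup>2 = P" "(cmod z2')\<^sup>2 = Q"
    using PQ by (simp_all add: z1'_def z2'_def)
  \<comment> \<open>the rotations for which one of the three points is undefined\<close>
  define B where "B = (\<Union>t\<in>{t1, t2, t3}. {E. r \<and> phase t * E \<in> undefined_phases p q n z1' z2'})"
  have "finite B"
  proof (cases r)
    case True
    then have "finite (undefined_phases p q n z1' z2')"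
      using finite_undefined_phases[of z1' z2' p q n] PQ den unfolding z' by (simp add: z1'_def z2'_def)
    moreover have "inj_on (\<lambda>E. phase t * E) UNIV" if "t \<in> {t1, t2, t3}" for t
      using that mult_nz by (auto simp: inj_on_def phase_def)
    ultimately have "finite ((\<lambda>E. phase t * E) -` undefined_phases p q n z1' z2' \<inter> UNIV)"
      if "t \<in> {t1, t2, t3}" for t
      using that by (intro finite_vimage_IntI) auto
    then show ?thesis
      using True unfolding B_def by (intro finite_UN_I) (auto simp: vimage_def)
  qed (simp add: B_def)
  define k where "k = complex_of_real (coefU r p q n P Q * coefV r p q n P Q * (P * Q * (sqrt P * sqrt Q)))"
  define K where "K = P * Q * ((coefU r p q n P Q)\<^sup>2 * P) + P * Q * ((coefV r p q n P Q)\<^sup>2 * Q)"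
  define c where "c = k * (of_real (R3\<^sup>2) * d2\<^sup>2 - of_real (R2\<^sup>2) * d3\<^sup>2)"
  define x where "x = K * ((cmod d3)\<^sup>2 * R2\<^sup>2 - (cmod d2)\<^sup>2 * R3\<^sup>2) / 2"
  have circle: "Re (c * E ^ 3) = x" if E: "cmod E = 1" "E \<notin> B" for E
  proof -
    define \<alpha> \<beta> where "\<alpha> = lin_coeff r p q n (z1' * E) z2'" and "\<beta> = conj_coeff r p q n (z1' * E) z2'"
    have zE: "(cmod (z1' * E))\<^sup>2 = P"
      using E z' by (simp add: norm_mult)
    have base_E: "tri 0 (z1' * E) z2' \<in> base_triangles"
    proof -
      have "cmod (z1' * E) \<noteq> cmod z2'"
        using zE z' PQ by metis
      moreover have "z1' * E \<noteq> 0" "z2' \<noteq> 0"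
        using zE z' PQ by auto
      ultimately show ?thesis
        by (simp add: base_triangles_tri_iff)
    qed
    then have nd_E: "cmod (z1' * E) \<noteq> cmod z2'"
      by (simp add: base_triangles_tri_iff)
    have curve: "triangle_curve X \<Psi> (tri 0 (z1' * E) z2') t = Some (real_affine 0 \<alpha> \<beta> (pt (m t)))"
      if "t \<in> {t1, t2, t3}" for t
      unfolding X_def \<alpha>_def \<beta>_def m_def
    proof (rule triangle_curve_defined[OF fam nd_E])
      show "denom r p q n ((cmod (z1' * E))\<^sup>2) ((cmod z2')\<^sup>2) \<noteq> 0"
        unfolding zE z' by (rule den)
      show "multiplier \<Psi> t \<noteq> 0"
        using that mult_nz by blast
      show "multiplier \<Psi> t / cnj (multiplier \<Psi> t) \<notin> undefined_phases p q n (z1' * E) z2'" if r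
        using that E \<open>t \<in> {t1, t2, t3}\<close> undefined_phases_rotate[OF E(1)] unfolding B_def phase_def by blast
    qed
    obtain F where F: "similarity_map F"
      "\<And>t x. triangle_curve X \<Psi> (tri 0 (z1' * E) z2') t = Some x \<Longrightarrow> x = F (\<gamma> t)"
      using \<gamma>[OF base_E] by blast
    obtain s where s: "s > 0" "\<And>x y. norm (F x - F y) = s * norm (x - y)"
      using similarity_dist[OF F(1)] by blast
    have diff: "norm (real_affine 0 \<alpha> \<beta> (pt y) - real_affine 0 \<alpha> \<beta> (pt y')) =
        cmod (\<alpha> * (y - y') + \<beta> * cnj (y - y'))" for y y'
      unfolding real_affine_def pt_linear(2)[symmetric] norm_pt by (simp add: algebra_simps)
    have n2: "cmod (\<alpha> * d2 + \<beta> * cnj d2) = s * R2"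
      unfolding d2_def diff[symmetric] R2_def s(2)[symmetric] using F(2) curve by (metis insertCI)
    have n3: "cmod (\<alpha> * d3 + \<beta> * cnj d3) = s * R3"
      unfolding d3_def diff[symmetric] R3_def s(2)[symmetric] using F(2) curve by (metis insertCI)
    have "(cmod (\<alpha> * d2 + \<beta> * cnj d2))\<^sup>2 * R3\<^sup>2 = (cmod (\<alpha> * d3 + \<beta> * cnj d3))\<^sup>2 * R2\<^sup>2"
      unfolding n2 n3 by (simp add: power_mult_distrib)
    moreover have "(cmod \<alpha>)\<^sup>2 + (cmod \<beta>)\<^sup>2 = K"
      unfolding \<alpha>_def \<beta>_def cmod_coeffs zE z' K_def ..
    moreover have "\<alpha> * cnj \<beta> = k * E ^ 3"
    proof -
      have "complex_of_real (sqrt P) * of_real (sqrt P) = of_real P"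
        "complex_of_real (sqrt Q) * of_real (sqrt Q) = of_real Q"
        using PQ by (simp_all flip: of_real_mult)
      then have "z1' * z1' * z2' * (z2' * z2' * z1') = of_real (P * Q * (sqrt P * sqrt Q))"
        unfolding z1'_def z2'_def by simp
      moreover have "\<alpha> * cnj \<beta> = of_real (coefU r p q n P Q) * of_real (coefV r p q n P Q)
          * (z1' * z1' * z2' * (z2' * z2' * z1')) * E ^ 3"
        unfolding \<alpha>_def \<beta>_def lin_coeff_def conj_coeff_def zE z' covU_def covV_def
        by (simp add: z1'_def z2'_def power2_eq_square power3_eq_cube)
      ultimately show ?thesis
        unfolding k_def by simp
    qed
    ultimately have "(K * (cmod d2)\<^sup>2 + 2 * Re (k * E ^ 3 * d2\<^sup>2)) * R3\<^sup>2 =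
        (K * (cmod d3)\<^sup>2 + 2 * Re (k * E ^ 3 * d3\<^sup>2)) * R2\<^sup>2"
      unfolding cmod_sq_real_linear by simp
    moreover have "Re (c * E ^ 3) = R3\<^sup>2 * Re (k * E ^ 3 * d2\<^sup>2) - R2\<^sup>2 * Re (k * E ^ 3 * d3\<^sup>2)"
    proof -
      have "c * E ^ 3 = of_real (R3\<^sup>2) * (k * E ^ 3 * d2\<^sup>2) - of_real (R2\<^sup>2) * (k * E ^ 3 * d3\<^sup>2)"
        by (simp add: c_def algebra_simps)
      moreover have "Re (of_real y * w) = y * Re w" for y w
        by simp
      ultimately show ?thesis
        by (simp only: minus_complex.sel)
    qed
    ultimately show ?thesis
      unfolding x_def by (simp add: algebra_simps)
  qed
  have "c = 0"
  proof (rule ccontr)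
    assume "c \<noteq> 0"
    then have "finite {E. cmod E = 1 \<and> Re (c * E ^ 3) = x}"
      by (rule finite_unit_circle_Re) simp
    moreover have "{E. cmod E = 1} \<subseteq> {E. cmod E = 1 \<and> Re (c * E ^ 3) = x} \<union> B"
      using circle by blast
    ultimately show False
      using infinite_unit_circle \<open>finite B\<close> by (meson finite_Un finite_subset)
  qed
  moreover have "k \<noteq> 0"
    using nonzero PQ by (simp add: k_def)
  ultimately have "(of_real R3 * d2)\<^sup>2 = (of_real R2 * d3)\<^sup>2"
    by (simp add: c_def power_mult_distrib)
  then have "of_real R3 * d2 = of_real R2 * d3 \<or> of_real R3 * d2 = - (of_real R2 * d3)"
    by (simp only: power2_eq_iff)
  then have "R3 * Im (d2 * cnj d3) = 0"
  proof
    assume *: "of_real R3 * d2 = of_real R2 * d3"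
    have "R3 * Im (d2 * cnj d3) = Im (of_real R3 * d2 * cnj d3)"
      by (simp add: algebra_simps)
    also have "\<dots> = 0"
      unfolding * by simp
    finally show ?thesis .
  next
    assume *: "of_real R3 * d2 = - (of_real R2 * d3)"
    have "R3 * Im (d2 * cnj d3) = Im (of_real R3 * d2 * cnj d3)"
      by (simp add: algebra_simps)
    also have "\<dots> = 0"
      unfolding * by simp
    finally show ?thesis .
  qed
  then show False
    using indep R by simp
qed

text \<open>Otherwise there is a shape, normalised to \<open>P - Q = 1\<close>, at which the center exists and neither of
the two coefficients vanishes, since only finitely many shapes violate this. The preceding lemma excludes
such a shape.\<close>

theorem invariant_imp_isodynamic_or_isogonic:
  assumes fam: "triangle_family \<Psi>"
    and inv: "invariant (quad_center r p q n) \<Psi>"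
    and base: "\<Delta> \<in> base_triangles"
    and nc: "\<not> collinear (curve_trace (quad_center r p q n) \<Psi> \<Delta>)"
  shows "n = 2 * p \<and> p\<^sup>2 = 3 * q\<^sup>2 \<and> q \<noteq> 0"
proof -
  obtain z0 z1 z2 where \<Delta>: "\<Delta> = tri z0 z1 z2"
    by (rule tri_surj)
  note * = non_collinear_curve[OF fam base[unfolded \<Delta>] nc[unfolded \<Delta>]]
  have pqn: "p \<noteq> 0 \<or> q \<noteq> 0 \<or> n \<noteq> 0"
    using *(1) by (cases r) (auto simp: denom_def shifted_level_def level_def)
  have rn: "n \<noteq> 0" if r
    using *(2) that by (auto simp: lin_coeff_def conj_coeff_def coefU_def coefV_def)
  have special: "n = 2 * p \<and> p\<^sup>2 = 3 * q\<^sup>2"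
  proof (rule ccontr)
    assume not_special: "\<not> ?thesis"
    define R where "R = {v. 3 / 2 * n - v * shape_level p q n v = 0} \<union>
      (if r then {v. (shape_level p q n v)\<^sup>2 - 3 * n * v * shape_level p q n v + 9 / 4 * n\<^sup>2 = 0} else {}) \<union>
      {v. (shape_level p q n v)\<^sup>2 = (3 / 2 * n)\<^sup>2}"
    have "finite (if r then {v. (shape_level p q n v)\<^sup>2 - 3 * n * v * shape_level p q n v + 9 / 4 * n\<^sup>2 = 0} else {})"
      using finite_shape_sets(3)[OF pqn] rn by simp
    then have "finite R"
      unfolding R_def using finite_shape_sets[OF pqn] not_special by blast
    then obtain v where v: "v > 1" "v \<notin> R"
      using infinite_Ioi[of "1 :: real"] finite_subset[of "{1<..}" R] by auto
    define P Q where "P = (v + 1) / 2" and "Q = (v - 1) / 2"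
    have PQ: "P > 0" "Q > 0" "P \<noteq> Q" "P - Q = 1" "v = (P + Q) / \<bar>P - Q\<bar>"
      using v(1) by (simp_all add: P_def Q_def field_simps)
    have den: "denom r p q n P Q \<noteq> 0"
      using denom_shape[OF PQ(3,5), of p q n] v(2) unfolding PQ(4)
      by (cases r) (simp_all add: R_def)
    have "shifted_level p q n P Q = shape_level p q n v"
      using shifted_level_shape[OF PQ(3,5), of p q n] PQ(4) by simp
    then have "(shifted_level p q n P Q)\<^sup>2 \<noteq> (3 / 2 * n)\<^sup>2"
      using v(2) by (simp add: R_def)
    then have "shifted_level p q n P Q - 3 / 2 * n \<noteq> 0" "shifted_level p q n P Q + 3 / 2 * n \<noteq> 0"
      by (auto simp: power2_eq_iff)
    then have "coefU r p q n P Q \<noteq> 0" "coefV r p q n P Q \<noteq> 0"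
      unfolding coefU_def coefV_def PQ(4) using den rn by auto
    then show False
      using invariant_imp_coef_zero[OF fam inv base nc PQ(1-3) den] by blast
  qed
  then show ?thesis
    using pqn by auto
qed

text \<open>Here \<open>h\<^sup>2 = e\<^sup>2 \<noteq> 0\<close> for every base triangle, so exactly one of the two coefficients vanishes.\<close>

theorem invariant_quad_center:
  assumes fam: "triangle_family \<Psi>" and special: "n = 2 * p" "p\<^sup>2 = 3 * q\<^sup>2" "q \<noteq> 0"
  shows "invariant (quad_center r p q n) \<Psi>"
  unfolding invariant_def
proof (intro exI[of _ "\<lambda>t. pt (model_point (multiplier \<Psi> t))"] ballI)
  fix \<Delta> assume base: "\<Delta> \<in> base_triangles"
  obtain z0 z1 z2 where \<Delta>: "\<Delta> = tri z0 z1 z2"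
    by (rule tri_surj)
  have nd: "cmod z1 \<noteq> cmod z2" "z1 \<noteq> 0" "z2 \<noteq> 0"
    using base by (simp_all add: \<Delta> base_triangles_tri_iff)
  define P Q where "P = (cmod z1)\<^sup>2" and "Q = (cmod z2)\<^sup>2"
  have "P \<noteq> Q"
    using nd by (simp add: P_def Q_def)
  define \<alpha> \<beta> where "\<alpha> = lin_coeff r p q n z1 z2" and "\<beta> = conj_coeff r p q n z1 z2"
  show "\<exists>F. similarity_map F \<and> (\<forall>t x. triangle_curve (quad_center r p q n) \<Psi> \<Delta> t = Some x \<longrightarrow>
      x = F (pt (model_point (multiplier \<Psi> t))))"
  proof (cases "denom r p q n P Q = 0")
    case True
    then have "triangle_curve (quad_center r p q n) \<Psi> \<Delta> t = None" for t
      using triangle_curve_real_affine(3)[OF fam nd(1), of r p q n z0 t]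
      unfolding \<Delta> P_def Q_def by (cases rule: option.exhaust) auto
    moreover have "similarity_map (real_affine 0 0 1)"
      by (rule similarity_map_real_affine) simp
    ultimately show ?thesis
      by auto
  next
    case False
    define h e where "h = shifted_level p q n P Q" and "e = 3 / 2 * n * (P - Q)"
    have "p \<noteq> 0"
      using special by auto
    then have "e \<noteq> 0"
      using \<open>P \<noteq> Q\<close> special(1) by (simp add: e_def)
    have "h = - 3 * sqrt 3 * q * \<bar>P - Q\<bar>"
      by (simp add: h_def shifted_level_def level_def special(1) algebra_simps)
    then have "h\<^sup>2 = 9 * (3 * q\<^sup>2) * (P - Q)\<^sup>2"
      by (simp add: power_mult_distrib)
    also have "\<dots> = e\<^sup>2"
      unfolding special(2)[symmetric] e_def special(1) by (simp add: power_mult_distrib)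
    finally have "h = e \<or> h = - e"
      by (simp add: power2_eq_iff)
    then have "coefU r p q n P Q = 0 \<and> coefV r p q n P Q \<noteq> 0 \<or>
        coefU r p q n P Q \<noteq> 0 \<and> coefV r p q n P Q = 0"
      using \<open>e \<noteq> 0\<close> \<open>p \<noteq> 0\<close> special(1) False
      unfolding coefU_def coefV_def h_def[symmetric] e_def[symmetric] by auto
    then have "\<alpha> = 0 \<and> \<beta> \<noteq> 0 \<or> \<alpha> \<noteq> 0 \<and> \<beta> = 0"
      using nd by (auto simp: \<alpha>_def \<beta>_def lin_coeff_def conj_coeff_def covU_def covV_def P_def Q_def)
    then have "similarity_map (real_affine z0 \<alpha> \<beta>)"
      by (rule similarity_map_real_affine)
    then show ?thesis
      using triangle_curve_real_affine(1)[OF fam nd(1)] unfolding \<Delta> \<alpha>_def \<beta>_def by blast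
  qed
qed

lemma quad_center_scale:
  assumes "c \<noteq> 0"
  shows "quad_center r (c * p) (c * q) (c * n) = quad_center r p q n"
proof
  fix \<Delta>
  obtain z0 z1 z2 where \<Delta>: "\<Delta> = tri z0 z1 z2"
    by (rule tri_surj)
  have level: "level (c * p) (c * q) P Q = c * level p q P Q" for P Q
    by (simp add: level_def algebra_simps)
  have shifted_level: "shifted_level (c * p) (c * q) (c * n) P Q = c * shifted_level p q n P Q" for P Q
    by (simp add: shifted_level_def level algebra_simps)
  have denom: "denom r (c * p) (c * q) (c * n) P Q = (if r then c * c else c) * denom r p q n P Q" for P Q
    by (simp add: denom_def shifted_level power2_eq_square algebra_simps)
  have coef: "coefU r (c * p) (c * q) (c * n) P Q = coefU r p q n P Q" (is ?U)
    "coefV r (c * p) (c * q) (c * n) P Q = coefV r p q n P Q" (is ?V) for P Q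
  proof -
    have num: "3 * (c * n) * (c * h - 3 / 2 * (c * n) * (P - Q)) = c * c * (3 * n * (h - 3 / 2 * n * (P - Q)))"
      "3 * (c * n) * (c * h + 3 / 2 * (c * n) * (P - Q)) = c * c * (3 * n * (h + 3 / 2 * n * (P - Q)))"
      "c * h - 3 / 2 * (c * n) * (P - Q) = c * (h - 3 / 2 * n * (P - Q))"
      "c * h + 3 / 2 * (c * n) * (P - Q) = c * (h + 3 / 2 * n * (P - Q))" for h
      by (simp_all add: algebra_simps)
    have U: ?U if r
      using that assms unfolding coefU_def denom shifted_level num by simp
    have U': ?U if "\<not> r"
      using that assms unfolding coefU_def denom shifted_level num by simp
    have V: ?V if r
      using that assms unfolding coefV_def denom shifted_level num by simp
    have V': ?V if "\<not> r"
      using that assms unfolding coefV_def denom shifted_level num by simp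
    show ?U ?V
      using U U' V V' by blast+
  qed
  show "quad_center r (c * p) (c * q) (c * n) \<Delta> = quad_center r p q n \<Delta>"
  proof (cases "cmod z1 = cmod z2")
    case True
    then show ?thesis
      by (simp add: \<Delta> quad_center_degenerate)
  next
    case False
    then show ?thesis
      using assms unfolding \<Delta> quad_center_tri[OF False] denom coef level
      by (simp add: mult.assoc)
  qed
qed

text \<open>For \<open>n = 0\<close> the three barycentric weights agree. One parameter must vanish
because otherwise the level may vanish for some triangles, where the center is then undefined.\<close>

lemma quad_center_centroid:
  assumes "(p = 0) \<noteq> (q = 0)"
  shows "quad_center True p q 0 = centroid"
proof
  fix \<Delta>
  obtain z0 z1 z2 where \<Delta>: "\<Delta> = tri z0 z1 z2"
    by (rule tri_surj)
  show "quad_center True p q 0 \<Delta> = centroid \<Delta>"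
  proof (cases "cmod z1 = cmod z2")
    case True
    then have "tri z0 z1 z2 \<notin> triangles"
      by (simp add: tri_in_triangles_iff)
    then have "centroid \<Delta> = None"
      by (simp add: \<Delta> tri_def)
    then show ?thesis
      using True by (simp add: \<Delta> quad_center_degenerate)
  next
    case False
    define P Q where "P = (cmod z1)\<^sup>2" and "Q = (cmod z2)\<^sup>2"
    have "P \<noteq> Q" "P \<ge> 0" "Q \<ge> 0"
      using False by (simp_all add: P_def Q_def)
    then have level: "level p q P Q \<noteq> 0"
      using assms by (auto simp: level_def)
    have "quad_center True p q 0 \<Delta> = Some (pt z0)"
      using level unfolding \<Delta> quad_center_tri[OF False] P_def[symmetric] Q_def[symmetric]
      by (simp add: denom_def shifted_level_def coefU_def coefV_def)
    moreover have "centroid \<Delta> = Some (pt z0)"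
    proof -
      have "tri z0 z1 z2 \<in> triangles"
        using False by (simp add: tri_in_triangles_iff)
      moreover have "(1 / 3) *\<^sub>R (pt (z0 + z1 + z2) + pt (z0 + \<omega> * z1 + cnj \<omega> * z2) +
          pt (z0 + cnj \<omega> * z1 + \<omega> * z2)) = pt z0"
        unfolding pt_linear(1,3)[symmetric] by (simp add: rot3_simps algebra_simps scaleR_conv_of_real)
      ultimately show ?thesis
        by (simp add: \<Delta> tri_def)
    qed
    ultimately show ?thesis
      by simp
  qed
qed

section \<open>The families Gamma and Xi\<close>

lemma psi_Gamma_quad: "psi_Gamma l0 l1 = quad_fun (sqrt 3 * l0) l1 (2 * sqrt 3 * l0)"
  by (intro ext) (simp add: psi_Gamma_def quad_fun_def algebra_simps)

lemma psi_Xi_quad: "psi_Xi l0 l1 = quad_fun (l1 - l0) 0 (- 2 * l0)"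
  by (intro ext) (simp add: psi_Xi_def quad_fun_def algebra_simps)

lemma X_quad_center:
  "X13 = quad_center True (sqrt 3) 1 (2 * sqrt 3)"
  "X14 = quad_center True (- sqrt 3) 1 (2 * - sqrt 3)"
  "X15 = quad_center False (sqrt 3) 1 (2 * sqrt 3)"
  "X16 = quad_center False (- sqrt 3) 1 (2 * - sqrt 3)"
  by (simp_all add: X13_def X14_def X15_def X16_def psi_Gamma_quad quad_center_def)

lemma quad_center_in_Omega_inv:
  assumes "n = 2 * p" "p\<^sup>2 = 3 * q\<^sup>2" "q \<noteq> 0"
  shows "quad_center r p q n \<in> Omega_inv"
proof -
  define w where "w = p / q"
  have "w\<^sup>2 = (sqrt 3)\<^sup>2"
    using assms by (simp add: w_def power_divide)
  then have "w = sqrt 3 \<or> w = - sqrt 3"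
    by (simp only: power2_eq_iff)
  moreover have "quad_center r p q n = quad_center r w 1 (2 * w)"
    using quad_center_scale[OF assms(3), of r w 1 "2 * w"] assms(1,3) by (simp add: w_def)
  ultimately show ?thesis
    unfolding Omega_inv_def X_quad_center by (cases r) auto
qed

lemma Omega_set_quad_center:
  assumes "\<psi> \<in> Omega_set" "triangle_center_function \<psi>"
  obtains r p q n where "center_of \<psi> = quad_center r p q n" "p \<noteq> 0 \<or> q \<noteq> 0 \<or> n \<noteq> 0"
    "n = 0 \<Longrightarrow> p = 0 \<or> q = 0"
proof -
  obtain r p q n where \<psi>: "\<psi> = (if r then recip (quad_fun p q n) else quad_fun p q n)"
    "n = 0 \<longrightarrow> p = 0 \<or> q = 0"
  proof -
    consider l0 l1 where "\<psi> = psi_Gamma l0 l1" | l0 l1 where "\<psi> = recip (psi_Gamma l0 l1)"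
      | l0 l1 where "\<psi> = psi_Xi l0 l1" | l0 l1 where "\<psi> = recip (psi_Xi l0 l1)"
      using assms(1) unfolding Omega_set_def Gamma_set_def Xi_set_def by blast
    then show ?thesis
    proof cases
      case (1 l0 l1)
      then show ?thesis
        using that[of False "sqrt 3 * l0" l1 "2 * sqrt 3 * l0"] by (simp add: psi_Gamma_quad)
    next
      case (2 l0 l1)
      then show ?thesis
        using that[of True "sqrt 3 * l0" l1 "2 * sqrt 3 * l0"] by (simp add: psi_Gamma_quad)
    next
      case (3 l0 l1)
      then show ?thesis
        using that[of False "l1 - l0" 0 "- 2 * l0"] by (simp add: psi_Xi_quad)
    next
      case (4 l0 l1)
      then show ?thesis
        using that[of True "l1 - l0" 0 "- 2 * l0"] by (simp add: psi_Xi_quad)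
    qed
  qed
  obtain a b c v where "\<psi> a b c = Some v" "v \<noteq> 0"
    using assms(2) unfolding triangle_center_function_def by blast
  then have "p \<noteq> 0 \<or> q \<noteq> 0 \<or> n \<noteq> 0"
    unfolding \<psi>(1) by (auto simp: quad_fun_def recip_def split: if_splits)
  then show ?thesis
    using that[of r p q n] \<psi> by (simp add: quad_center_def)
qed

theorem theorem1:
  fixes \<Psi> :: "real \<Rightarrow> real ^ 3"
  assumes "decomposable \<Psi>"
  shows "(\<forall>\<psi> \<in> Omega_set. triangle_center_function \<psi> \<longrightarrow> semi_invariant (center_of \<psi>) \<Psi>) \<and>
    (\<forall>\<psi> \<in> Omega_set. triangle_center_function \<psi> \<longrightarrow> center_of \<psi> \<noteq> centroid \<longrightarrow>
       finite (brocard_cot ` {\<Delta> \<in> base_triangles. \<not> curve_generating (center_of \<psi>) \<Delta>})) \<and>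
    (\<Psi> = aliquot \<longrightarrow>
       (\<forall>\<psi> \<in> Omega_set. triangle_center_function \<psi> \<longrightarrow>
          (\<forall>\<Delta> \<in> base_triangles. curve_generating (center_of \<psi>) \<Delta> \<longrightarrow>
             (\<exists>k T. k \<noteq> 0 \<and> sheared (maclaurin_trisectrix k) T \<and>
                    traces (curve_trace (center_of \<psi>) \<Psi> \<Delta>) T)))) \<and>
    (\<Psi> = nedian \<longrightarrow>
       (\<forall>\<psi> \<in> Omega_set. triangle_center_function \<psi> \<longrightarrow>
          (\<forall>\<Delta> \<in> base_triangles. curve_generating (center_of \<psi>) \<Delta> \<longrightarrow>
             (\<exists>k T. k \<noteq> 0 \<and> sheared (limacon_trisectrix k) T \<and>
                    traces (curve_trace (center_of \<psi>) \<Psi> \<Delta>) T)))) \<and>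
    (\<forall>X \<in> Omega_inv. invariant X \<Psi>) \<and>
    (\<forall>\<psi> \<in> Omega_set. triangle_center_function \<psi> \<longrightarrow>
       (\<exists>\<Delta> \<in> base_triangles. \<not> collinear (curve_trace (center_of \<psi>) \<Psi> \<Delta>)) \<longrightarrow>
       invariant (center_of \<psi>) \<Psi> \<longrightarrow> center_of \<psi> \<in> Omega_inv)"
proof -
  have fam: "triangle_family \<Psi>"
    using assms by (simp add: decomposable_def)
  have semi: "semi_invariant (center_of \<psi>) \<Psi>"
    if "\<psi> \<in> Omega_set" "triangle_center_function \<psi>" for \<psi>
    using Omega_set_quad_center[OF that] semi_invariant_quad_center[OF fam] by metis
  have fin: "finite (brocard_cot ` {\<Delta> \<in> base_triangles. \<not> curve_generating (center_of \<psi>) \<Delta>})"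
    if \<psi>: "\<psi> \<in> Omega_set" "triangle_center_function \<psi>" "center_of \<psi> \<noteq> centroid" for \<psi>
  proof -
    obtain r p q n where q: "center_of \<psi> = quad_center r p q n" "p \<noteq> 0 \<or> q \<noteq> 0 \<or> n \<noteq> 0"
      "n = 0 \<Longrightarrow> p = 0 \<or> q = 0"
      using Omega_set_quad_center[OF \<psi>(1,2)] by blast
    have "n \<noteq> 0" if r
      using q \<psi>(3) that quad_center_centroid[of p q] by auto
    then show ?thesis
      unfolding q(1) using finite_exceptional_brocard[OF q(2)] by blast
  qed
  have aliquot: "\<exists>k T. k \<noteq> 0 \<and> sheared (maclaurin_trisectrix k) T \<and>
      traces (curve_trace (center_of \<psi>) aliquot \<Delta>) T"
    if \<psi>: "\<psi> \<in> Omega_set" "triangle_center_function \<psi>" and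
      \<Delta>: "\<Delta> \<in> base_triangles" "curve_generating (center_of \<psi>) \<Delta>" for \<psi> \<Delta>
    using Omega_set_quad_center[OF \<psi>] aliquot_curve_maclaurin[OF \<Delta>(1)] \<Delta>(2) by metis
  have nedian: "\<exists>k T. k \<noteq> 0 \<and> sheared (limacon_trisectrix k) T \<and>
      traces (curve_trace (center_of \<psi>) nedian \<Delta>) T"
    if \<psi>: "\<psi> \<in> Omega_set" "triangle_center_function \<psi>" and
      \<Delta>: "\<Delta> \<in> base_triangles" "curve_generating (center_of \<psi>) \<Delta>" for \<psi> \<Delta>
    using Omega_set_quad_center[OF \<psi>] nedian_curve_limacon[OF \<Delta>(1)] \<Delta>(2) by metis
  have inv: "invariant X \<Psi>" if "X \<in> Omega_inv" for X
    using that unfolding Omega_inv_def X_quad_center by (auto intro!: invariant_quad_center[OF fam])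
  have uniq: "center_of \<psi> \<in> Omega_inv"
    if \<psi>: "\<psi> \<in> Omega_set" "triangle_center_function \<psi>"
      and \<Delta>: "\<Delta> \<in> base_triangles" "\<not> collinear (curve_trace (center_of \<psi>) \<Psi> \<Delta>)"
      and "invariant (center_of \<psi>) \<Psi>" for \<psi> \<Delta>
  proof -
    obtain r p q n where q: "center_of \<psi> = quad_center r p q n"
      using Omega_set_quad_center[OF \<psi>] by blast
    show ?thesis
      using invariant_imp_isodynamic_or_isogonic[OF fam _ \<Delta>(1)] \<Delta>(2) that(5)
        quad_center_in_Omega_inv unfolding q by blast
  qed
  show ?thesis
    using semi fin aliquot nedian inv uniq by blast
qed

end
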